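(* Let $(\Omega,\mu)$ be a measure space such that $L^p(\Omega,\mu)$ is infinite dimensional and separable for every $1<p<\infty$, let $(\varphi_n)_{n\ge0}$ and $(\psi_n)_{n\ge0}$ be two orthonormal bases of $L^2(\Omega,\mu)$, and let $\Phi_N$, $\Psi_N$ be the orthogonal projections on $\operatorname{span}\{\varphi_0,\dots,\varphi_N\}$ and $\operatorname{span}\{\psi_0,\dots,\psi_N\}$ respectively. Let $1<p_0<2$ and assume that the conditions (L), (R), (B), (C) and (D) stated in the context hold. Then, for $1<p<\infty$, one has $\Psi_N f\to f$ in $L^p(\Omega,\mu)$ as $N\to\infty$ for every $f\in L^p(\Omega,\mu)$ if and only if $p_0<p<p_0'$.
   Context: Notation: $p'=\frac{p}{p-1}$ is the dual index of $p$. $A\lesssim B$ means $A\le CB$ with a constant $C$ independent of the indices $n,k,N$ and of the function $f$ (it may depend on $p$); $A\gtrsim B$ means $B\lesssim A$. A kernel $K(x,y)$ defines the integral operator $Kf(x)=\int_\Omega K(x,y)f(y)\,d\mu(y)$. $\Phi_N$ also denotes its kernel $\Phi_N(x,y)=\sum_{n=0}^N\varphi_n(x)\overline{\varphi_n(y)}$, and similarly $\Psi_N(x,y)=\sum_{n=0}^N\psi_n(x)\overline{\psi_n(y)}$; via these kernels the operators are also considered on $L^p(\Omega,\mu)$. Conditions: (L) For every $1<p<\infty$ and every $n$, $\varphi_n\in L^p(\mu)$, and there is $0\le\gamma_p<1$ such that $\|\varphi_n\|_{L^p(\mu)}\lesssim n^{\gamma_p}$ for $n\ge1$. Moreover $0\le\alpha_p:=\gamma_p+\gamma_{p'}<1$,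 and $\alpha_p=0$ if $p\in(p_0,p_0')$. In other words, $\|\varphi_n\|_{L^p(\mu)}\|\varphi_n\|_{L^{p'}(\mu)}\lesssim1$ for $p\in(p_0,p_0')$, and $\|\varphi_n\|_{L^p(\mu)}\|\varphi_n\|_{L^{p'}(\mu)}\lesssim n^{\alpha_p}$ with $\alpha_p<1$ for $p\notin(p_0,p_0')$. (R) Let $\alpha_k^n=\langle\psi_n,\varphi_k\rangle_{L^2(\mu)}$, so that $\psi_n=\sum_{k=0}^\infty\alpha_k^n\varphi_k$. The $\alpha_k^n$ satisfy a three term recursion formula $$f(k,n)\alpha_k^n=a_k\alpha_{k-1}^n+a_{k+1}\alpha_{k+1}^n\qquad(k\ge0,\ \alpha_{-1}^n:=0),$$ and there is an integer $n_0\ge0$ such that: (1) $|a_k|\le\frac12$ for all $k$; (2) for each fixed $n$ there is $k_n$ such that $|f(k,n)|\gtrsim k^2$ for $k\ge k_n$ (the constant may depend on $n$); (3) for $n\ge n_0$ and every $k\ge0$, $|f(k,n)|\gtrsim k|k-n|$; (4) $\left|\frac{a_{n+1}}{f(n+1,n)}-\frac{a_{n+2}}{f(n+2,n+1)}\right|\lesssim n^{-2}$ for $n\ge \max(n_0,1)$. (B) Let $\tilde\Phi_N$ be the integral operator with kernel $\tilde\Phi_N(x,y)=\sum_{n=0}^N\varphi_n(x)\overline{\varphi_{n+1}(y)}$. For every $1<p<\infty$, $\tilde\Phi_N$ defines a bounded linear operator on $L^p(\mu)$ and there exists $\beta_p<1$ such that $\|\tilde\Phi_Nf\|_{L^p(\mu)}\lesssim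 N^{\beta_p}\|f\|_{L^p(\mu)}$ for every $f\in L^p(\mu)$ and $N\ge1$. (C) For $1<p<\infty$: $\Phi_Nf\to f$ in $L^p(\Omega,\mu)$ for every $f\in L^p(\Omega,\mu)$ if and only if $p_0<p<p_0'$. (D) There is a set $\mathcal D$, dense in every $L^p(\mu)$, $1<p<\infty$, such that for every $1<p<\infty$ and every $f\in\mathcal D$, $\Phi_Nf\to f$ and $\Psi_Nf\to f$ in $L^p(\mu)$ as $N\to\infty$. *)

theory Defs
  imports "HOL-Analysis.Analysis"
begin

section \<open>Lebesgue spaces of complex functions\<close>

text \<open>
  The elements of \<open>Lp M p\<close> are functions, not classes modulo null sets; accordingly \<open>Lp_norm\<close> is
  only a seminorm, and equality in \<open>L\<^sup>p\<close> is equality almost everywhere.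
  Because the Bochner integral of a non-integrable function is \<open>0\<close>, every use of \<open>Lp_norm\<close> below
  is accompanied by membership in \<open>Lp\<close>.
\<close>

definition Lp :: "'a measure \<Rightarrow> real \<Rightarrow> ('a \<Rightarrow> complex) set" where
  "Lp M p = {f \<in> borel_measurable M. integrable M (\<lambda>x. norm (f x) powr p)}"

definition Lp_norm :: "'a measure \<Rightarrow> real \<Rightarrow> ('a \<Rightarrow> complex) \<Rightarrow> real" where
  "Lp_norm M p f = (\<integral>x. norm (f x) powr p \<partial>M) powr (1 / p)"

definition Lp_tendsto ::
    "'a measure \<Rightarrow> real \<Rightarrow> (nat \<Rightarrow> 'a \<Rightarrow> complex) \<Rightarrow> ('a \<Rightarrow> complex) \<Rightarrow> bool" where
  "Lp_tendsto M p F f \<longleftrightarrow> (\<forall>N. F N \<in> Lp M p) \<and> f \<in> Lp M p \<and>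
     (\<lambda>N. Lp_norm M p (\<lambda>x. F N x - f x)) \<longlonglongrightarrow> 0"

definition dense_Lp :: "'a measure \<Rightarrow> real \<Rightarrow> ('a \<Rightarrow> complex) set \<Rightarrow> bool" where
  "dense_Lp M p S \<longleftrightarrow> S \<subseteq> Lp M p \<and>
     (\<forall>f\<in>Lp M p. \<forall>\<epsilon>>0. \<exists>g\<in>S. Lp_norm M p (\<lambda>x. f x - g x) < \<epsilon>)"

definition separable_Lp :: "'a measure \<Rightarrow> real \<Rightarrow> bool" where
  "separable_Lp M p \<longleftrightarrow> (\<exists>S. countable S \<and> dense_Lp M p S)"

definition infinite_dim_Lp :: "'a measure \<Rightarrow> real \<Rightarrow> bool" where
  "infinite_dim_Lp M p \<longleftrightarrow>
     \<not> (\<exists>B. finite B \<and> B \<subseteq> Lp M p \<and>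
          (\<forall>f\<in>Lp M p. \<exists>c. AE x in M. f x = (\<Sum>b\<in>B. c b * b x)))"

definition bounded_linear_Lp ::
    "'a measure \<Rightarrow> real \<Rightarrow> (('a \<Rightarrow> complex) \<Rightarrow> 'a \<Rightarrow> complex) \<Rightarrow> bool" where
  "bounded_linear_Lp M p T \<longleftrightarrow>
     (\<forall>f\<in>Lp M p. T f \<in> Lp M p) \<and>
     (\<forall>f\<in>Lp M p. \<forall>g\<in>Lp M p. AE x in M. T (\<lambda>y. f y + g y) x = T f x + T g x) \<and>
     (\<forall>f\<in>Lp M p. \<forall>c. AE x in M. T (\<lambda>y. c * f y) x = c * T f x) \<and>
     (\<exists>C. \<forall>f\<in>Lp M p. Lp_norm M p (T f) \<le> C * Lp_norm M p f)"

definition dual_index :: "real \<Rightarrow> real" where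
  "dual_index p = p / (p - 1)"


section \<open>Orthonormal bases and partial sum operators\<close>

definition L2_inner :: "'a measure \<Rightarrow> ('a \<Rightarrow> complex) \<Rightarrow> ('a \<Rightarrow> complex) \<Rightarrow> complex" where
  "L2_inner M f g = (\<integral>x. f x * cnj (g x) \<partial>M)"

definition span_upto :: "(nat \<Rightarrow> 'a \<Rightarrow> complex) \<Rightarrow> nat \<Rightarrow> ('a \<Rightarrow> complex) set" where
  "span_upto \<phi> N = range (\<lambda>c x. \<Sum>n\<le>N. c n * \<phi> n x)"

definition orthonormal_L2 :: "'a measure \<Rightarrow> (nat \<Rightarrow> 'a \<Rightarrow> complex) \<Rightarrow> bool" where
  "orthonormal_L2 M \<phi> \<longleftrightarrow> (\<forall>n. \<phi> n \<in> Lp M 2) \<and>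
     (\<forall>m n. L2_inner M (\<phi> m) (\<phi> n) = (if m = n then 1 else 0))"

definition orthonormal_basis_L2 :: "'a measure \<Rightarrow> (nat \<Rightarrow> 'a \<Rightarrow> complex) \<Rightarrow> bool" where
  "orthonormal_basis_L2 M \<phi> \<longleftrightarrow> orthonormal_L2 M \<phi> \<and> dense_Lp M 2 (\<Union>N. span_upto \<phi> N)"

definition kernel_op ::
    "'a measure \<Rightarrow> ('a \<Rightarrow> 'a \<Rightarrow> complex) \<Rightarrow> ('a \<Rightarrow> complex) \<Rightarrow> 'a \<Rightarrow> complex" where
  "kernel_op M K f x = (\<integral>y. K x y * f y \<partial>M)"

definition proj_kernel :: "(nat \<Rightarrow> 'a \<Rightarrow> complex) \<Rightarrow> nat \<Rightarrow> 'a \<Rightarrow> 'a \<Rightarrow> complex" where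
  "proj_kernel \<phi> N x y = (\<Sum>n\<le>N. \<phi> n x * cnj (\<phi> n y))"

definition shifted_kernel :: "(nat \<Rightarrow> 'a \<Rightarrow> complex) \<Rightarrow> nat \<Rightarrow> 'a \<Rightarrow> 'a \<Rightarrow> complex" where
  "shifted_kernel \<phi> N x y = (\<Sum>n\<le>N. \<phi> n x * cnj (\<phi> (Suc n) y))"

text \<open>
  The partial sum operator is given by its kernel, which makes sense on every \<open>L\<^sup>p\<close>. The lemma
  \<open>proj_op_orthogonal_projection\<close> below shows that on \<open>L\<^sup>2\<close> it is the orthogonal projection onto
  the span of the first \<open>N + 1\<close> functions.
\<close>

definition proj_op ::
    "'a measure \<Rightarrow> (nat \<Rightarrow> 'a \<Rightarrow> complex) \<Rightarrow> nat \<Rightarrow> ('a \<Rightarrow> complex) \<Rightarrow> 'a \<Rightarrow> complex" where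
  "proj_op M \<phi> N = kernel_op M (proj_kernel \<phi> N)"

lemma integrable_L2_mult_cnj:
  assumes "f \<in> Lp M 2" "g \<in> Lp M 2"
  shows "integrable M (\<lambda>x. f x * cnj (g x))"
proof (rule Bochner_Integration.integrable_bound)
  have [measurable]: "f \<in> borel_measurable M" "g \<in> borel_measurable M"
    using assms by (auto simp: Lp_def)
  show "integrable M (\<lambda>x. norm (f x) powr 2 + norm (g x) powr 2)"
    using assms by (auto simp: Lp_def)
  show "(\<lambda>x. f x * cnj (g x)) \<in> borel_measurable M"
    by (intro borel_measurable_times borel_measurable_continuous_on[where g = g and f = cnj])
       (auto intro: continuous_intros)
  have "norm (f x * cnj (g x)) \<le> norm (norm (f x) powr 2 + norm (g x) powr 2)" for x
  proof -
    have "2 * (norm (f x) * norm (g x)) \<le> norm (f x) ^ 2 + norm (g x) ^ 2"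
      using sum_squares_bound[of "norm (f x)" "norm (g x)"] by (simp add: mult.assoc)
    moreover have "0 \<le> norm (f x) * norm (g x)" by simp
    ultimately have "norm (f x) * norm (g x) \<le> norm (f x) ^ 2 + norm (g x) ^ 2" by linarith
    then show ?thesis by (simp add: norm_mult)
  qed
  then show "AE x in M. norm (f x * cnj (g x)) \<le> norm (norm (f x) powr 2 + norm (g x) powr 2)"
    by simp
qed

lemma proj_op_eq:
  assumes "orthonormal_L2 M \<phi>" "f \<in> Lp M 2"
  shows "proj_op M \<phi> N f = (\<lambda>x. \<Sum>n\<le>N. L2_inner M f (\<phi> n) * \<phi> n x)"
proof
  fix x
  have int: "integrable M (\<lambda>y. f y * cnj (\<phi> n y))" for n
    using assms by (intro integrable_L2_mult_cnj) (auto simp: orthonormal_L2_def)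
  have "proj_op M \<phi> N f x = (\<integral>y. (\<Sum>n\<le>N. \<phi> n x * (f y * cnj (\<phi> n y))) \<partial>M)"
    unfolding proj_op_def kernel_op_def proj_kernel_def
    by (simp add: sum_distrib_left sum_distrib_right mult_ac)
  also have "\<dots> = (\<Sum>n\<le>N. \<phi> n x * (\<integral>y. f y * cnj (\<phi> n y) \<partial>M))"
    by (subst Bochner_Integration.integral_sum) (use int in auto)
  finally show "proj_op M \<phi> N f x = (\<Sum>n\<le>N. L2_inner M f (\<phi> n) * \<phi> n x)"
    by (simp add: L2_inner_def mult.commute)
qed

lemma proj_op_orthogonal_projection:
  assumes "orthonormal_L2 M \<phi>" "f \<in> Lp M 2"
  shows "proj_op M \<phi> N f \<in> span_upto \<phi> N"
    and "g \<in> span_upto \<phi> N \<Longrightarrow> L2_inner M (\<lambda>x. f x - proj_op M \<phi> N f x) g = 0"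
proof -
  show "proj_op M \<phi> N f \<in> span_upto \<phi> N"
    unfolding proj_op_eq[OF assms] span_upto_def by (rule rangeI)
  assume "g \<in> span_upto \<phi> N"
  then obtain c where g: "g = (\<lambda>x. \<Sum>m\<le>N. c m * \<phi> m x)"
    by (auto simp: span_upto_def)
  have \<phi>: "\<phi> n \<in> Lp M 2" for n
    using assms by (auto simp: orthonormal_L2_def)
  have on: "(\<integral>x. \<phi> n x * cnj (\<phi> m x) \<partial>M) = (if n = m then 1 else 0)" for n m
    using assms(1) unfolding orthonormal_L2_def L2_inner_def by blast
  let ?a = "\<lambda>n. L2_inner M f (\<phi> n)"
  have i1: "integrable M (\<lambda>x. f x * cnj (\<phi> m x))" for m
    by (intro integrable_L2_mult_cnj assms \<phi>)
  have i2: "integrable M (\<lambda>x. \<phi> n x * cnj (\<phi> m x))" for n m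
    by (intro integrable_L2_mult_cnj \<phi>)
  have pw: "(f x - (\<Sum>n\<le>N. ?a n * \<phi> n x)) * cnj (\<Sum>m\<le>N. c m * \<phi> m x) =
      (\<Sum>m\<le>N. cnj (c m) *
        (f x * cnj (\<phi> m x) - (\<Sum>n\<le>N. ?a n * (\<phi> n x * cnj (\<phi> m x)))))" for x
  proof -
    define s where "s = (\<Sum>n\<le>N. ?a n * \<phi> n x)"
    have "(\<Sum>n\<le>N. ?a n * (\<phi> n x * cnj (\<phi> m x))) = s * cnj (\<phi> m x)" for m
      by (simp add: s_def sum_distrib_right mult.assoc)
    moreover have "(f x - s) * cnj (\<Sum>m\<le>N. c m * \<phi> m x) =
        (\<Sum>m\<le>N. cnj (c m) * (f x * cnj (\<phi> m x) - s * cnj (\<phi> m x)))"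
      unfolding cnj_sum sum_distrib_left by (intro sum.cong refl) (simp add: algebra_simps)
    ultimately show ?thesis by (simp add: s_def)
  qed
  have "L2_inner M (\<lambda>x. f x - proj_op M \<phi> N f x) g =
      (\<integral>x. (\<Sum>m\<le>N. cnj (c m) *
        (f x * cnj (\<phi> m x) - (\<Sum>n\<le>N. ?a n * (\<phi> n x * cnj (\<phi> m x))))) \<partial>M)"
    unfolding proj_op_eq[OF assms] g L2_inner_def[of M "\<lambda>x. f x - (\<Sum>n\<le>N. ?a n * \<phi> n x)"]
    by (simp only: pw)
  also have "\<dots> = (\<Sum>m\<le>N. cnj (c m) * (?a m - (\<Sum>n\<le>N. ?a n * (if n = m then 1 else 0))))"
    using i1 i2 by (simp add: on L2_inner_def)
  also have "\<dots> = 0"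
    by (intro sum.neutral) (simp add: if_distrib cong: if_cong)
  finally show "L2_inner M (\<lambda>x. f x - proj_op M \<phi> N f x) g = 0" .
qed


section \<open>Hypotheses on the two bases\<close>

text \<open>
  An estimate \<open>A \<lesssim> B\<close> is rendered as \<open>\<exists>C>0. \<dots> A \<le> C * B\<close>, with \<open>C\<close> chosen before the
  indices and the function; it may depend on \<open>p\<close>.
\<close>

definition norm_growth :: "'a measure \<Rightarrow> real \<Rightarrow> (nat \<Rightarrow> 'a \<Rightarrow> complex) \<Rightarrow> bool" where
  "norm_growth M p0 \<phi> \<longleftrightarrow>
     (\<exists>\<gamma>::real \<Rightarrow> real. \<forall>p>1.
        (\<forall>n. \<phi> n \<in> Lp M p) \<and>
        0 \<le> \<gamma> p \<and> \<gamma> p < 1 \<and>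
        (\<exists>C>0. \<forall>n\<ge>1. Lp_norm M p (\<phi> n) \<le> C * real n powr \<gamma> p) \<and>
        0 \<le> \<gamma> p + \<gamma> (dual_index p) \<and> \<gamma> p + \<gamma> (dual_index p) < 1 \<and>
        (p0 < p \<and> p < dual_index p0 \<longrightarrow> \<gamma> p + \<gamma> (dual_index p) = 0))"

text \<open>Here \<open>\<alpha> k n\<close> stands for the \<open>k\<close>-th coefficient of the \<open>n\<close>-th function of the second basis.\<close>

definition three_term_recursion :: "(nat \<Rightarrow> nat \<Rightarrow> complex) \<Rightarrow> bool" where
  "three_term_recursion \<alpha> \<longleftrightarrow>
     (\<exists>(f :: nat \<Rightarrow> nat \<Rightarrow> complex) (a :: nat \<Rightarrow> complex) (n0 :: nat).
        (\<forall>k n. f k n * \<alpha> k n =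
           a k * (if k = 0 then 0 else \<alpha> (k - 1) n) + a (k + 1) * \<alpha> (k + 1) n) \<and>
        (\<forall>k. norm (a k) \<le> 1 / 2) \<and>
        (\<forall>n. \<exists>kn. \<exists>C>0. \<forall>k\<ge>kn. (real k)\<^sup>2 \<le> C * norm (f k n)) \<and>
        (\<exists>C>0. \<forall>n\<ge>n0. \<forall>k. real k * \<bar>real k - real n\<bar> \<le> C * norm (f k n)) \<and>
        (\<exists>C>0. \<forall>n\<ge>max n0 1.
           norm (a (n + 1) / f (n + 1) n - a (n + 2) / f (n + 2) (n + 1)) \<le> C * (1 / (real n)\<^sup>2)))"

definition shifted_sums_bounded :: "'a measure \<Rightarrow> (nat \<Rightarrow> 'a \<Rightarrow> complex) \<Rightarrow> bool" where
  "shifted_sums_bounded M \<phi> \<longleftrightarrow>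
     (\<forall>p>1.
        (\<forall>N. bounded_linear_Lp M p (kernel_op M (shifted_kernel \<phi> N))) \<and>
        (\<exists>\<beta><1. \<exists>C>0. \<forall>f\<in>Lp M p. \<forall>N\<ge>1.
           Lp_norm M p (kernel_op M (shifted_kernel \<phi> N) f) \<le> C * real N powr \<beta> * Lp_norm M p f))"

definition partial_sums_converge ::
    "'a measure \<Rightarrow> (nat \<Rightarrow> 'a \<Rightarrow> complex) \<Rightarrow> real \<Rightarrow> bool" where
  "partial_sums_converge M \<phi> p \<longleftrightarrow>
     (\<forall>f\<in>Lp M p. Lp_tendsto M p (\<lambda>N. proj_op M \<phi> N f) f)"

definition common_dense_convergence ::
    "'a measure \<Rightarrow> (nat \<Rightarrow> 'a \<Rightarrow> complex) \<Rightarrow> (nat \<Rightarrow> 'a \<Rightarrow> complex) \<Rightarrow> bool" where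
  "common_dense_convergence M \<phi> \<psi> \<longleftrightarrow>
     (\<exists>D. \<forall>p>1. dense_Lp M p D \<and>
        (\<forall>f\<in>D. Lp_tendsto M p (\<lambda>N. proj_op M \<phi> N f) f \<and>
               Lp_tendsto M p (\<lambda>N. proj_op M \<psi> N f) f))"

end

theory Submission
  imports Defs
begin

text \<open>
  The two families of partial sums are compared directly. Write \<open>u \<otimes> v\<close> for the operator
  \<open>f \<mapsto> \<langle>f, v\<rangle> u\<close>, so that the difference of the two partial sum operators is
  \<open>D\<^sub>N = (\<Sum>n\<le>N. \<psi>\<^sub>n \<otimes> \<psi>\<^sub>n - \<phi>\<^sub>n \<otimes> \<phi>\<^sub>n)\<close>. The point is that \<open>D\<^sub>N\<close> is bounded on \<open>L\<^sup>p\<close> uniformly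
  in \<open>N\<close>, for every \<open>1 < p < \<infinity>\<close> (\<open>partial_sums_differ_boundedly\<close>). Since \<open>D\<^sub>N f \<longlonglongrightarrow> 0\<close> on a dense
  set, it then tends to \<open>0\<close> strongly, so the partial sums of \<open>\<psi>\<close> converge on \<open>L\<^sup>p\<close> exactly when those
  of \<open>\<phi>\<close> do (\<open>partial_sums_converge_transfer\<close>), and for \<open>\<phi>\<close> the range of exponents is known.

  For the uniform bound, let \<open>\<alpha> k n\<close> be the coefficient of \<open>\<phi>\<^sub>k\<close> in \<open>\<psi>\<^sub>n\<close>. In the recursion
  the factor of \<open>\<alpha> k n\<close> has size at least about \<open>k\<bar>k - n\<bar>\<close> while the right-hand side only involves the
  two neighbouring coefficients. One use of it makes \<open>\<alpha> k n\<close> of size \<open>1 / (k\<bar>k - n\<bar>)\<close> off the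
  diagonal, two uses give the square of this for \<open>\<bar>k - n\<bar> \<ge> 2\<close> (\<open>off_diagonal_decay\<close>). The entries with
  \<open>k = 0\<close>, for which the lower bound is void, are controlled by the orthogonality of the \<open>\<psi>\<^sub>n\<close>
  (\<open>zeroth_entry_le\<close>). Hence
  \<open>\<psi>\<^sub>n = b\<^sub>n \<phi>\<^sub>n + c\<^sub>n \<phi>\<^bsub>n-1\<^esub> + d\<^sub>n \<phi>\<^bsub>n+1\<^esub> + r\<^sub>n\<close> with \<open>c\<^sub>n, d\<^sub>n = O(1/n)\<close>,
  \<open>1 - \<bar>b\<^sub>n\<bar>\<^sup>2 = O(1/n\<^sup>2)\<close> and \<open>r\<^sub>n\<close> of size \<open>n\<^sup>-\<^sup>2\<close> relative to the growth of the norms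
  of \<open>\<phi>\<^sub>n\<close>.

  In \<open>\<psi>\<^sub>n \<otimes> \<psi>\<^sub>n - \<phi>\<^sub>n \<otimes> \<phi>\<^sub>n\<close> the terms of order \<open>1/n\<close> are multiples of
  \<open>\<phi>\<^sub>n \<otimes> \<phi>\<^bsub>n+1\<^esub>\<close>, \<open>\<phi>\<^bsub>n-1\<^esub> \<otimes> \<phi>\<^sub>n\<close> and their adjoints, and would not be summable on
  their own. They telescope: orthogonality of \<open>\<psi>\<^sub>n\<close> and \<open>\<psi>\<^bsub>n+1\<^esub>\<close>
  says that the coefficient of \<open>\<phi>\<^sub>n \<otimes> \<phi>\<^bsub>n+1\<^esub>\<close> produced by \<open>\<psi>\<^sub>n\<close> cancels the one produced by
  \<open>\<psi>\<^bsub>n+1\<^esub>\<close> up to \<open>O(1/n\<^sup>2)\<close> (\<open>almost_isometry\<close>). What is left of the \<open>n\<close>-th summand,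
  apart from the boundary terms of the telescoping sum, has operator norm \<open>O(n powr (\<gamma>\<^sub>p + \<gamma>\<^sub>q - 2))\<close> with \<open>q\<close> dual to \<open>p\<close>, and this is summable because
  \<open>\<gamma>\<^sub>p + \<gamma>\<^sub>q < 1\<close>.
\<close>

section \<open>Lebesgue seminorms\<close>

lemma Lp_measurable: "f \<in> Lp M p \<Longrightarrow> f \<in> borel_measurable M"
  by (simp add: Lp_def)

lemma Lp_norm_nonneg: "0 \<le> Lp_norm M p f"
  by (simp add: Lp_norm_def)

lemma integral_le_of_Lp_norm_le:
  assumes "0 < p" "Lp_norm M p f \<le> a"
  shows "(\<integral>x. norm (f x) powr p \<partial>M) \<le> a powr p"
proof -
  have "(\<integral>x. norm (f x) powr p \<partial>M) = Lp_norm M p f powr p"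
    using assms(1) by (simp add: Lp_norm_def powr_powr)
  also have "\<dots> \<le> a powr p"
    using assms by (intro powr_mono2) (auto simp: Lp_norm_nonneg)
  finally show ?thesis .
qed

lemma Lp_norm_le_of_integral_le:
  assumes "0 < p" "0 \<le> a" "(\<integral>x. norm (f x) powr p \<partial>M) \<le> a powr p"
  shows "Lp_norm M p f \<le> a"
proof -
  have "Lp_norm M p f \<le> (a powr p) powr (1 / p)"
    unfolding Lp_norm_def using assms by (intro powr_mono2) auto
  also have "\<dots> = a" using assms by (simp add: powr_powr)
  finally show ?thesis .
qed

lemma powr_weighted_mean_le:
  fixes u v l p :: real
  assumes "1 \<le> p" "0 \<le> u" "0 \<le> v" "0 \<le> l" "l \<le> 1"
  shows "(l * u + (1 - l) * v) powr p \<le> l * u powr p + (1 - l) * v powr p"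
proof -
  have scale: "(t * w) powr p \<le> t * w powr p" if "0 \<le> t" "t \<le> 1" "0 \<le> w" for t w :: real
  proof (cases "t = 0")
    case False
    then have "t powr p \<le> t powr 1" using that assms(1) by (intro powr_mono') auto
    then show ?thesis using that False by (simp add: powr_mult mult_right_mono)
  qed simp
  \<comment> \<open>At the end point 0, where \<open>powr\<close> is 0, only \<open>l powr p \<le> l\<close> has to be known.\<close>
  consider "u = 0" | "v = 0" | "0 < u" "0 < v" using assms by linarith
  then show ?thesis
  proof cases
    case 3
    have "(l *\<^sub>R u + (1 - l) *\<^sub>R v) powr p \<le> l * u powr p + (1 - l) * v powr p"
      using convex_onD[OF powr_convex[OF assms(1)], of "1 - l" u v] assms 3 by simp
    then show ?thesis by simp
  qed (use assms scale[of "1 - l" v] scale[of l u] in auto)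
qed

text \<open>
  Minkowski's inequality by convexity of \<open>t \<mapsto> t\<^sup>p\<close>. The functions are normalised by numbers
  slightly larger than their norms, so that vanishing norms need no separate case; the same
  device proves Hoelder's inequality below.
\<close>

lemma Lp_add:
  assumes "1 \<le> p" "f \<in> Lp M p" "g \<in> Lp M p"
  shows "(\<lambda>x. f x + g x) \<in> Lp M p"
    and "Lp_norm M p (\<lambda>x. f x + g x) \<le> Lp_norm M p f + Lp_norm M p g"
proof -
  have [measurable]: "f \<in> borel_measurable M" "g \<in> borel_measurable M"
    using assms by (auto simp: Lp_def)
  have if': "integrable M (\<lambda>x. norm (f x) powr p)" and ig: "integrable M (\<lambda>x. norm (g x) powr p)"
    using assms by (auto simp: Lp_def)
  have main: "(\<lambda>x. f x + g x) \<in> Lp M p \<and> Lp_norm M p (\<lambda>x. f x + g x) \<le> a + b"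
    if a: "Lp_norm M p f < a" and b: "Lp_norm M p g < b" for a b
  proof -
    have pos: "0 < a" "0 < b" using a b Lp_norm_nonneg[of M p f] Lp_norm_nonneg[of M p g] by linarith+
    define l where "l = a / (a + b)"
    have l: "0 \<le> l" "l \<le> 1" "1 - l = b / (a + b)" using pos by (auto simp: l_def field_simps)
    define h where "h x = (a + b) powr p * (l * (norm (f x) powr p / a powr p)
        + (1 - l) * (norm (g x) powr p / b powr p))" for x
    have ih: "integrable M h" unfolding h_def using if' ig by auto
    have pw: "norm (f x + g x) powr p \<le> h x" for x
    proof -
      have "norm (f x + g x) powr p
          \<le> ((a + b) * (l * (norm (f x) / a) + (1 - l) * (norm (g x) / b))) powr p"
      proof (intro powr_mono2)
        have "(a + b) * (l * (norm (f x) / a) + (1 - l) * (norm (g x) / b)) = norm (f x) + norm (g x)"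
          unfolding l(3) unfolding l_def using pos by (simp add: divide_simps)
        then show "norm (f x + g x) \<le> (a + b) * (l * (norm (f x) / a) + (1 - l) * (norm (g x) / b))"
          by (simp add: norm_triangle_ineq)
      qed (use assms in auto)
      also have "\<dots> = (a + b) powr p * (l * (norm (f x) / a) + (1 - l) * (norm (g x) / b)) powr p"
        by (rule powr_mult)
      also have "\<dots> \<le> (a + b) powr p * (l * (norm (f x) / a) powr p + (1 - l) * (norm (g x) / b) powr p)"
        using pos l assms(1) by (intro mult_left_mono powr_weighted_mean_le) auto
      also have "\<dots> = h x" using pos by (simp add: h_def powr_divide)
      finally show ?thesis .
    qed
    have int: "integrable M (\<lambda>x. norm (f x + g x) powr p)"
      by (rule Bochner_Integration.integrable_bound[OF ih]) (use pw in \<open>auto intro: order_trans[OF _ abs_ge_self]\<close>)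
    have "(\<integral>x. norm (f x + g x) powr p \<partial>M) \<le> (\<integral>x. h x \<partial>M)"
      by (intro integral_mono int ih pw)
    also have "\<dots> = (a + b) powr p * (l * ((\<integral>x. norm (f x) powr p \<partial>M) / a powr p)
        + (1 - l) * ((\<integral>x. norm (g x) powr p \<partial>M) / b powr p))"
      unfolding h_def using if' ig by simp
    also have "\<dots> \<le> (a + b) powr p * (l * 1 + (1 - l) * 1)"
    proof (intro mult_left_mono add_mono)
      show "(\<integral>x. norm (f x) powr p \<partial>M) / a powr p \<le> 1"
        using integral_le_of_Lp_norm_le[of p M f a] a assms(1) pos by (simp add: divide_simps)
      show "(\<integral>x. norm (g x) powr p \<partial>M) / b powr p \<le> 1"
        using integral_le_of_Lp_norm_le[of p M g b] b assms(1) pos by (simp add: divide_simps)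
    qed (use l in auto)
    finally have "(\<integral>x. norm (f x + g x) powr p \<partial>M) \<le> (a + b) powr p" by simp
    then have "Lp_norm M p (\<lambda>x. f x + g x) \<le> a + b"
      using assms(1) pos by (intro Lp_norm_le_of_integral_le) auto
    then show ?thesis using int by (simp add: Lp_def)
  qed
  show "(\<lambda>x. f x + g x) \<in> Lp M p" using main[of "Lp_norm M p f + 1" "Lp_norm M p g + 1"] by simp
  show "Lp_norm M p (\<lambda>x. f x + g x) \<le> Lp_norm M p f + Lp_norm M p g"
  proof (rule field_le_epsilon)
    fix e :: real assume "0 < e"
    then show "Lp_norm M p (\<lambda>x. f x + g x) \<le> Lp_norm M p f + Lp_norm M p g + e"
      using main[of "Lp_norm M p f + e / 2" "Lp_norm M p g + e / 2"] by simp
  qed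
qed

lemma Lp_scale:
  assumes "0 < p" "f \<in> Lp M p"
  shows "(\<lambda>x. c * f x) \<in> Lp M p"
    and "Lp_norm M p (\<lambda>x. c * f x) = norm c * Lp_norm M p f"
proof -
  have eq: "norm (c * f x) powr p = norm c powr p * norm (f x) powr p" for x
    by (simp add: norm_mult powr_mult)
  show "(\<lambda>x. c * f x) \<in> Lp M p"
    using assms(2) unfolding Lp_def by (auto simp: eq)
  show "Lp_norm M p (\<lambda>x. c * f x) = norm c * Lp_norm M p f"
    unfolding Lp_norm_def eq using assms by (simp add: powr_mult powr_powr)
qed

lemma Lp_zero: "0 < p \<Longrightarrow> (\<lambda>x. 0) \<in> Lp M p" "Lp_norm M p (\<lambda>x. 0) = 0"
  by (simp_all add: Lp_def Lp_norm_def)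

lemma Lp_diff:
  assumes "1 \<le> p" "f \<in> Lp M p" "g \<in> Lp M p"
  shows "(\<lambda>x. f x - g x) \<in> Lp M p"
    and "Lp_norm M p (\<lambda>x. f x - g x) \<le> Lp_norm M p f + Lp_norm M p g"
  using Lp_add[OF assms(1,2) Lp_scale(1)[of p g M "-1"]] Lp_scale(2)[of p g M "-1"] assms by auto

lemma Lp_sum:
  assumes "1 \<le> p" "finite A" "\<And>i. i \<in> A \<Longrightarrow> f i \<in> Lp M p"
  shows "(\<lambda>x. \<Sum>i\<in>A. f i x) \<in> Lp M p \<and> Lp_norm M p (\<lambda>x. \<Sum>i\<in>A. f i x) \<le> (\<Sum>i\<in>A. Lp_norm M p (f i))"
  using assms(2,3)
proof (induction rule: finite_induct)
  case empty
  then show ?case using assms(1) by (simp add: Lp_zero)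
next
  case (insert i A)
  then have "f i \<in> Lp M p" "(\<lambda>x. \<Sum>i\<in>A. f i x) \<in> Lp M p" by auto
  from Lp_add[OF assms(1) this] show ?case using insert by (auto intro: order_trans)
qed

lemma Lp_tendsto_add_null:
  assumes "1 \<le> p" "Lp_tendsto M p F f" "Lp_tendsto M p G (\<lambda>x. 0)"
  shows "Lp_tendsto M p (\<lambda>N x. F N x + G N x) f"
proof -
  have F: "F N \<in> Lp M p" "f \<in> Lp M p" and G: "G N \<in> Lp M p" for N
    using assms(2,3) by (auto simp: Lp_tendsto_def)
  have "(\<lambda>N. Lp_norm M p (\<lambda>x. F N x - f x) + Lp_norm M p (G N)) \<longlonglongrightarrow> 0 + 0"
    using assms(2,3) by (intro tendsto_add) (auto simp: Lp_tendsto_def)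
  moreover have "Lp_norm M p (\<lambda>x. F N x + G N x - f x)
      \<le> Lp_norm M p (\<lambda>x. F N x - f x) + Lp_norm M p (G N)" for N
    using Lp_add(2)[OF assms(1) Lp_diff(1)[OF assms(1) F(1) F(2)] G, of N N]
    by (simp add: algebra_simps)
  ultimately have "(\<lambda>N. Lp_norm M p (\<lambda>x. F N x + G N x - f x)) \<longlonglongrightarrow> 0"
    by (intro tendsto_sandwich[of "\<lambda>_. 0" "\<lambda>N. Lp_norm M p (\<lambda>x. F N x + G N x - f x)" sequentially
          "\<lambda>N. Lp_norm M p (\<lambda>x. F N x - f x) + Lp_norm M p (G N)"]) (auto simp: Lp_norm_nonneg)
  then show ?thesis using F G assms(1) by (auto simp: Lp_tendsto_def intro: Lp_add)
qed

lemma dual_index: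
  assumes "1 < p"
  shows "1 < dual_index p" "1 / p + 1 / dual_index p = 1"
  using assms by (auto simp: dual_index_def field_simps)

lemma Hoelder_inequality:
  assumes "1 < p" "f \<in> Lp M p" "g \<in> Lp M (dual_index p)"
  shows "integrable M (\<lambda>x. f x * cnj (g x))"
    and "norm (L2_inner M f g) \<le> Lp_norm M p f * Lp_norm M (dual_index p) g"
proof -
  define q where "q = dual_index p"
  have q: "1 < q" "1 / p + 1 / q = 1" using dual_index[OF assms(1)] by (auto simp: q_def)
  have [measurable]: "f \<in> borel_measurable M" "g \<in> borel_measurable M"
    using assms by (auto simp: Lp_def)
  have [measurable]: "(\<lambda>x. f x * cnj (g x)) \<in> borel_measurable M"
    by (intro borel_measurable_times borel_measurable_continuous_on[where g = g and f = cnj])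
       (auto intro: continuous_intros)
  have if': "integrable M (\<lambda>x. norm (f x) powr p)" and ig: "integrable M (\<lambda>x. norm (g x) powr q)"
    using assms by (auto simp: Lp_def q_def)
  have main: "integrable M (\<lambda>x. f x * cnj (g x)) \<and> norm (L2_inner M f g) \<le> a * b"
    if a: "Lp_norm M p f < a" and b: "Lp_norm M q g < b" for a b
  proof -
    have pos: "0 < a" "0 < b" using a b Lp_norm_nonneg[of M p f] Lp_norm_nonneg[of M q g] by linarith+
    define h where "h x = a * b * (norm (f x) powr p / a powr p / p + norm (g x) powr q / b powr q / q)" for x
    have ih: "integrable M h" unfolding h_def using if' ig by auto
    have pw: "norm (f x * cnj (g x)) \<le> h x" for x
    proof -
      have "norm (f x) / a * (norm (g x) / b) \<le> (norm (f x) / a) powr p / p + (norm (g x) / b) powr q / q"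
        using pos assms(1) q by (intro Youngs_inequality) auto
      then have "a * b * (norm (f x) / a * (norm (g x) / b)) \<le> h x"
        unfolding h_def using pos by (intro mult_left_mono) (auto simp: powr_divide)
      then show ?thesis using pos by (simp add: norm_mult)
    qed
    have int: "integrable M (\<lambda>x. f x * cnj (g x))"
      by (rule Bochner_Integration.integrable_bound[OF ih]) (use pw in \<open>auto intro: order_trans[OF _ abs_ge_self]\<close>)
    have "norm (L2_inner M f g) \<le> (\<integral>x. norm (f x * cnj (g x)) \<partial>M)"
      unfolding L2_inner_def by (rule integral_norm_bound)
    also have "\<dots> \<le> (\<integral>x. h x \<partial>M)"
      by (intro integral_mono integrable_norm int ih pw)
    also have "\<dots> = a * b * ((\<integral>x. norm (f x) powr p \<partial>M) / a powr p / p
        + (\<integral>x. norm (g x) powr q \<partial>M) / b powr q / q)"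
      unfolding h_def using if' ig by simp
    also have "\<dots> \<le> a * b * (1 / p + 1 / q)"
    proof (intro mult_left_mono add_mono divide_right_mono)
      show "(\<integral>x. norm (f x) powr p \<partial>M) / a powr p \<le> 1"
        using integral_le_of_Lp_norm_le[of p M f a] a assms(1) pos by (simp add: divide_simps)
      show "(\<integral>x. norm (g x) powr q \<partial>M) / b powr q \<le> 1"
        using integral_le_of_Lp_norm_le[of q M g b] b q(1) pos by (simp add: divide_simps)
    qed (use pos q assms in auto)
    finally show ?thesis using int q by simp
  qed
  show "integrable M (\<lambda>x. f x * cnj (g x))"
    using main[of "Lp_norm M p f + 1" "Lp_norm M q g + 1"] by simp
  have "((\<lambda>e. (Lp_norm M p f + e) * (Lp_norm M q g + e)) \<longlongrightarrow> (Lp_norm M p f + 0) * (Lp_norm M q g + 0)) (at_right 0)"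
    by (intro tendsto_intros)
  moreover have "\<forall>\<^sub>F e in at_right 0. norm (L2_inner M f g) \<le> (Lp_norm M p f + e) * (Lp_norm M q g + e)"
    using main by (auto simp: eventually_at_right_field intro!: exI[of _ 1])
  ultimately show "norm (L2_inner M f g) \<le> Lp_norm M p f * Lp_norm M (dual_index p) g"
    using tendsto_lowerbound[of "\<lambda>e. (Lp_norm M p f + e) * (Lp_norm M q g + e)"] by (simp add: q_def)
qed

text \<open>
  Norm bounds pass from approximants in one Lebesgue space to a limit taken in another: a
  subsequence converges almost everywhere, and Fatou's lemma applies.
\<close>

lemma Lp_of_L2_limit:
  assumes "0 < p" and g: "g \<in> borel_measurable M" and "0 \<le> B"
    and F: "\<And>N. F N \<in> Lp M p" "\<And>N. Lp_norm M p (F N) \<le> B"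
    and lim: "\<And>N. (\<lambda>x. F N x - g x) \<in> Lp M 2" "(\<lambda>N. Lp_norm M 2 (\<lambda>x. F N x - g x)) \<longlonglongrightarrow> 0"
  shows "g \<in> Lp M p" "Lp_norm M p g \<le> B"
proof -
  have [measurable]: "F N \<in> borel_measurable M" for N using F by (auto simp: Lp_def)
  note [measurable] = g
  have "(\<lambda>N. Lp_norm M 2 (\<lambda>x. F N x - g x) powr 2) \<longlonglongrightarrow> 0"
    using tendsto_mult[OF lim(2) lim(2)] by (simp add: power2_eq_square Lp_norm_nonneg)
  then have "(\<lambda>N. \<integral>x. norm (norm (F N x - g x) powr 2) \<partial>M) \<longlonglongrightarrow> 0"
    by (simp add: Lp_norm_def powr_powr del: powr_numeral)
  then obtain r where r: "strict_mono r" "AE x in M. (\<lambda>n. norm (F (r n) x - g x) powr 2) \<longlonglongrightarrow> 0"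
    using tendsto_L1_AE_subseq[of M "\<lambda>N x. norm (F N x - g x) powr 2"] lim(1) by (auto simp: Lp_def)
  have ptw: "(\<lambda>n. norm (F (r n) x) powr p) \<longlonglongrightarrow> norm (g x) powr p"
    if "(\<lambda>n. norm (F (r n) x - g x) powr 2) \<longlonglongrightarrow> 0" for x
  proof -
    have "(\<lambda>n. sqrt (norm (F (r n) x - g x) powr 2)) \<longlonglongrightarrow> sqrt 0"
      using that by (rule tendsto_real_sqrt)
    then have "(\<lambda>n. F (r n) x) \<longlonglongrightarrow> g x"
      by (simp add: LIM_zero_iff tendsto_norm_zero_iff)
    then show ?thesis using assms(1) by (intro tendsto_powr' tendsto_norm tendsto_const) auto
  qed
  have "(\<integral>\<^sup>+x. ennreal (norm (g x) powr p) \<partial>M) = (\<integral>\<^sup>+x. liminf (\<lambda>n. ennreal (norm (F (r n) x) powr p)) \<partial>M)"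
  proof (rule nn_integral_cong_AE)
    show "AE x in M. ennreal (norm (g x) powr p) = liminf (\<lambda>n. ennreal (norm (F (r n) x) powr p))"
      using r(2)
    proof eventually_elim
      case (elim x)
      have "(\<lambda>n. ennreal (norm (F (r n) x) powr p)) \<longlonglongrightarrow> ennreal (norm (g x) powr p)"
        by (intro tendsto_ennrealI ptw elim)
      then show ?case using lim_imp_Liminf[of sequentially] by fastforce
    qed
  qed
  also have "\<dots> \<le> liminf (\<lambda>n. \<integral>\<^sup>+x. ennreal (norm (F (r n) x) powr p) \<partial>M)"
    by (rule nn_integral_liminf) measurable
  also have "\<dots> \<le> ennreal (B powr p)"
  proof -
    have "(\<integral>\<^sup>+x. ennreal (norm (F N x) powr p) \<partial>M) \<le> ennreal (B powr p)" for N
    proof -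
      have "(\<integral>\<^sup>+x. ennreal (norm (F N x) powr p) \<partial>M) = ennreal (\<integral>x. norm (F N x) powr p \<partial>M)"
        using F(1) by (intro nn_integral_eq_integral) (auto simp: Lp_def)
      then show ?thesis
        using integral_le_of_Lp_norm_le[OF assms(1) F(2)] by (simp add: ennreal_leI)
    qed
    then show ?thesis by (intro Liminf_le) auto
  qed
  finally have fin: "(\<integral>\<^sup>+x. ennreal (norm (g x) powr p) \<partial>M) \<le> ennreal (B powr p)" .
  then have "integrable M (\<lambda>x. norm (g x) powr p)"
    by (intro integrableI_bounded) (auto intro: le_less_trans)
  then show gp: "g \<in> Lp M p" by (simp add: Lp_def)
  have "ennreal (\<integral>x. norm (g x) powr p \<partial>M) \<le> ennreal (B powr p)"
    using fin gp by (subst (asm) nn_integral_eq_integral) (auto simp: Lp_def)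
  then show "Lp_norm M p g \<le> B"
    using assms(1,3) by (intro Lp_norm_le_of_integral_le) (auto simp: ennreal_le_iff)
qed

section \<open>Weighted sums\<close>

text \<open>
  For \<open>k \<ge> 1\<close> this is, up to a constant, the lower bound assumed for the factor of the
  coefficient \<open>(k, n)\<close> in the recursion. The shift to \<open>k + 1\<close> keeps it from vanishing at \<open>k = 0\<close>, so that
  one formula describes the decay in the whole column off the diagonal.
\<close>

definition wt :: "nat \<Rightarrow> nat \<Rightarrow> real" where
  "wt k n = (real k + 1) * \<bar>real k - real n\<bar>"

lemma wt_pos: "k \<noteq> n \<Longrightarrow> 0 < wt k n"
  by (simp add: wt_def)

text \<open>
  Partial fractions: the weight separates into the distance of \<open>k\<close> from \<open>0\<close> and from \<open>n\<close>, at the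
  gain of a factor \<open>1 / (n + 1)\<close>.
\<close>

lemma inverse_wt_le:
  assumes "k \<noteq> n"
  shows "1 / wt k n \<le> (1 / (real k + 1) + 1 / \<bar>real k - real n\<bar>) / (real n + 1)"
proof -
  have pos: "0 < \<bar>real k - real n\<bar>" using assms by simp
  have "(1 / (real k + 1) + 1 / \<bar>real k - real n\<bar>) / (real n + 1)
      = (\<bar>real k - real n\<bar> + (real k + 1)) / (wt k n * (real n + 1))"
    using pos by (simp add: wt_def add_frac_eq)
  moreover have "1 / wt k n = (real n + 1) / (wt k n * (real n + 1))" by simp
  moreover have "(real n + 1) / (wt k n * (real n + 1))
      \<le> (\<bar>real k - real n\<bar> + (real k + 1)) / (wt k n * (real n + 1))"
    using wt_pos[OF assms] by (intro divide_right_mono) auto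
  ultimately show ?thesis by simp
qed

lemma wt_ge:
  assumes "k \<noteq> n" shows "real n \<le> wt k n"
proof (cases "k < n")
  case True
  have "0 \<le> real k * (real n - real k - 1)" using True by (intro mult_nonneg_nonneg) auto
  then show ?thesis using True by (simp add: wt_def algebra_simps)
next
  case False
  then have "1 * (real n + 1) \<le> \<bar>real k - real n\<bar> * (real k + 1)"
    using assms by (intro mult_mono) auto
  then show ?thesis by (simp add: wt_def mult.commute)
qed

lemma sum_distance_powr_le:
  fixes s :: real
  assumes "s < -1"
  shows "(\<Sum>k\<in>{..N} - {n}. \<bar>real k - real n\<bar> powr s) \<le> 2 * (\<Sum>j. (real j + 1) powr s)"
proof -
  define h where "h j = (real j + 1) powr s" for j
  have "summable (\<lambda>n. real (Suc n) powr s)"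
    using assms summable_real_powr_iff[of s] by (subst summable_Suc_iff) auto
  then have h: "summable h" by (simp add: h_def[abs_def] add.commute)
  have part: "(\<Sum>k\<in>A. \<bar>real k - real n\<bar> powr s) \<le> suminf h"
    if "finite A" "inj_on g A" "\<And>k. k \<in> A \<Longrightarrow> \<bar>real k - real n\<bar> = real (g k) + 1" for A g
  proof -
    have "(\<Sum>k\<in>A. \<bar>real k - real n\<bar> powr s) = sum h (g ` A)"
      using that by (subst sum.reindex) (auto simp: h_def intro!: sum.cong)
    also have "\<dots> \<le> suminf h" using that h by (intro sum_le_suminf) (auto simp: h_def)
    finally show ?thesis .
  qed
  have split: "{..N} - {n} = ({..N} \<inter> {..<n}) \<union> ({..N} \<inter> {n<..})" by auto
  have "(\<Sum>k\<in>{..N} - {n}. \<bar>real k - real n\<bar> powr s) =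
      (\<Sum>k\<in>{..N} \<inter> {..<n}. \<bar>real k - real n\<bar> powr s) + (\<Sum>k\<in>{..N} \<inter> {n<..}. \<bar>real k - real n\<bar> powr s)"
    by (subst split) (rule sum.union_disjoint, auto)
  also have "\<dots> \<le> suminf h + suminf h"
    by (intro add_mono part[where g = "\<lambda>k. n - 1 - k"] part[where g = "\<lambda>k. k - n - 1"])
       (auto simp: inj_on_def of_nat_diff)
  finally show ?thesis by (simp add: h_def[abs_def])
qed

text \<open>
  Summed against the norms of the first basis, which are at most of order \<open>(k + 1) powr g\<close>, coefficients of
  size \<open>1 / (wt k n)\<^sup>2\<close> give a gain of \<open>n\<^sup>-\<^sup>2\<close> over the norm at \<open>k = n\<close>. After
  squaring the partial fraction bound, both parts are convergent series since \<open>g < 1\<close>.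
\<close>

lemma sum_powr_over_wt_squared_le:
  fixes g :: real
  assumes "0 \<le> g" "g < 1"
  shows "\<exists>Z>0. \<forall>n N. (\<Sum>k\<in>{..N} - {n}. (real k + 1) powr g / (wt k n)\<^sup>2) \<le> Z * (real n + 1) powr (g - 2)"
proof -
  define Z where "Z = (\<Sum>j. (real j + 1) powr (g - 2))"
  have "summable (\<lambda>n. real (Suc n) powr (g - 2))"
    using assms summable_real_powr_iff[of "g - 2"] by (subst summable_Suc_iff) auto
  then have h: "summable (\<lambda>n. (real n + 1) powr (g - 2))" by (simp add: add.commute)
  have Z: "0 < Z" unfolding Z_def using h by (intro suminf_pos) auto
  have "(\<Sum>k\<in>{..N} - {n}. (real k + 1) powr g / (wt k n)\<^sup>2) \<le> 10 * Z * (real n + 1) powr (g - 2)" for n N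
  proof -
    define x where "x = real n + 1"
    have x: "1 \<le> x" by (simp add: x_def)
    have bound: "(real k + 1) powr g / (wt k n)\<^sup>2
        \<le> 2 / x\<^sup>2 * ((real k + 1) powr (g - 2) + 2 * x powr g * \<bar>real k - real n\<bar> powr (g - 2))"
      if "k \<noteq> n" for k
    proof -
      define u where "u = real k + 1"
      define v where "v = \<bar>real k - real n\<bar>"
      have u: "1 \<le> u" by (simp add: u_def)
      have v: "1 \<le> v" using that by (simp add: v_def)
      have "1 / wt k n \<le> (1 / u + 1 / v) / x"
        using inverse_wt_le[OF that] by (simp add: u_def v_def x_def)
      then have "(1 / wt k n)\<^sup>2 \<le> ((1 / u + 1 / v) / x)\<^sup>2"
        using wt_pos[OF that] by (intro power_mono) auto
      also have "\<dots> = (1 / u + 1 / v)\<^sup>2 / x\<^sup>2" by (simp add: power_divide)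
      also have "\<dots> \<le> 2 * ((1 / u)\<^sup>2 + (1 / v)\<^sup>2) / x\<^sup>2"
        using sum_squares_bound[of "1 / u" "1 / v"] by (intro divide_right_mono) (auto simp: power2_sum)
      finally have "1 / (wt k n)\<^sup>2 \<le> 2 / x\<^sup>2 * (1 / u\<^sup>2 + 1 / v\<^sup>2)"
        by (simp add: power_divide)
      then have "u powr g * (1 / (wt k n)\<^sup>2) \<le> u powr g * (2 / x\<^sup>2 * (1 / u\<^sup>2 + 1 / v\<^sup>2))"
        by (intro mult_left_mono) auto
      also have "\<dots> = 2 / x\<^sup>2 * (u powr g / u\<^sup>2 + u powr g / v\<^sup>2)" by (simp add: algebra_simps)
      also have "\<dots> \<le> 2 / x\<^sup>2 * (u powr (g - 2) + 2 * x powr g * v powr (g - 2))"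
      proof (intro mult_left_mono add_mono)
        show "u powr g / u\<^sup>2 \<le> u powr (g - 2)" using u by (simp add: powr_diff)
        have "u \<le> x + v" by (simp add: u_def x_def v_def)
        moreover have "0 \<le> (x - 1) * (v - 1)" using x v by (intro mult_nonneg_nonneg) auto
        moreover have "1 * 1 \<le> x * v" using x v by (intro mult_mono) auto
        ultimately have "u \<le> 2 * x * v" by (simp add: algebra_simps)
        then have "u powr g \<le> (2 * x * v) powr g" using u assms by (intro powr_mono2) auto
        also have "\<dots> = 2 powr g * x powr g * v powr g" using x v by (simp add: powr_mult)
        also have "\<dots> \<le> 2 * x powr g * v powr g"
          using powr_mono[of g 1 "2::real"] assms by (intro mult_right_mono) auto
        finally have "u powr g / v\<^sup>2 \<le> 2 * x powr g * v powr g / v\<^sup>2" by (intro divide_right_mono) auto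
        also have "\<dots> = 2 * x powr g * v powr (g - 2)" using v by (simp add: powr_diff)
        finally show "u powr g / v\<^sup>2 \<le> 2 * x powr g * v powr (g - 2)" .
      qed (use x in auto)
      finally show ?thesis by (simp add: u_def v_def)
    qed
    have "(\<Sum>k\<in>{..N} - {n}. (real k + 1) powr g / (wt k n)\<^sup>2)
        \<le> (\<Sum>k\<in>{..N} - {n}. 2 / x\<^sup>2 * ((real k + 1) powr (g - 2)
            + 2 * x powr g * \<bar>real k - real n\<bar> powr (g - 2)))"
      by (intro sum_mono bound) auto
    also have "\<dots> = 2 / x\<^sup>2 * ((\<Sum>k\<in>{..N} - {n}. (real k + 1) powr (g - 2))
        + 2 * x powr g * (\<Sum>k\<in>{..N} - {n}. \<bar>real k - real n\<bar> powr (g - 2)))"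
      by (simp add: sum_distrib_left sum.distrib algebra_simps)
    also have "\<dots> \<le> 2 / x\<^sup>2 * (Z * x powr g + 2 * x powr g * (2 * Z))"
    proof (intro mult_left_mono add_mono)
      have "(\<Sum>k\<in>{..N} - {n}. (real k + 1) powr (g - 2)) \<le> Z"
        unfolding Z_def using h by (intro sum_le_suminf) auto
      also have "\<dots> \<le> Z * x powr g" using Z x assms ge_one_powr_ge_zero[of x g] by simp
      finally show "(\<Sum>k\<in>{..N} - {n}. (real k + 1) powr (g - 2)) \<le> Z * x powr g" .
      show "(\<Sum>k\<in>{..N} - {n}. \<bar>real k - real n\<bar> powr (g - 2)) \<le> 2 * Z"
        unfolding Z_def using assms by (intro sum_distance_powr_le) auto
    qed (use x in auto)
    also have "\<dots> = 10 * Z * x powr (g - 2)" using x by (simp add: powr_diff algebra_simps)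
    finally show ?thesis by (simp add: x_def)
  qed
  then show ?thesis using Z by (intro exI[of _ "10 * Z"]) auto
qed

lemma summable_inverse_Suc_squared: "summable (\<lambda>k. 1 / (real k + 1)\<^sup>2)"
  using inverse_power_summable[of 2, where 'a = real] summable_Suc_iff[of "\<lambda>n. inverse ((real n)\<^sup>2)"]
  by (simp add: field_simps)

section \<open>Decay of the coefficients\<close>

lemma entries_of_unit_sequence:
  fixes v :: "nat \<Rightarrow> complex"
  assumes "(\<lambda>k. v k * cnj (v k)) sums 1"
  shows "(\<lambda>k. (norm (v k))\<^sup>2) sums 1" and "norm (v k) \<le> 1"
proof -
  have "(\<lambda>k. Re (v k * cnj (v k))) sums Re 1"
    using assms by (intro sums_Re) auto
  moreover have "Re (z * cnj z) = (norm z)\<^sup>2" for z :: complex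
    by (simp add: cmod_power2 power2_eq_square[symmetric])
  ultimately show sums: "(\<lambda>k. (norm (v k))\<^sup>2) sums 1" by (simp only: one_complex.simps)
  have "(norm (v k))\<^sup>2 \<le> (\<Sum>k. (norm (v k))\<^sup>2)"
    using sum_le_suminf[of "\<lambda>k. (norm (v k))\<^sup>2" "{k}"] sums by (auto simp: sums_iff)
  also have "\<dots> = 1" using sums by (simp add: sums_iff)
  finally show "norm (v k) \<le> 1" by (simp add: abs_square_le_1)
qed

text \<open>
  What is used of the matrix of coefficients \<open>\<alpha> k n\<close> of the second basis in the first: its columns
  are orthonormal, and the recursion bounds each entry of a late column by its two
  neighbours. This leaves the zeroth and the diagonal entries open. In \<open>decay\<close>, on the other hand,
  the column is arbitrary, but the constant depends on it.
\<close>

locale near_identity_matrix =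
  fixes \<alpha> :: "nat \<Rightarrow> nat \<Rightarrow> complex" and n0 :: nat and C :: real
  assumes C: "0 < C"
    and orthonormal: "\<And>m n. (\<lambda>k. \<alpha> k n * cnj (\<alpha> k m)) sums (if n = m then 1 else 0)"
    and neighbours: "\<And>k n. n0 \<le> n \<Longrightarrow> 1 \<le> k \<Longrightarrow>
      real k * \<bar>real k - real n\<bar> * norm (\<alpha> k n) \<le> C * (norm (\<alpha> (k - 1) n) + norm (\<alpha> (k + 1) n))"
    and decay: "\<And>n. \<exists>A. \<forall>k. norm (\<alpha> k n) \<le> A / (real k + 1)\<^sup>2"
    and n0: "1 \<le> n0"
begin

lemma norm_squares_sum: "(\<lambda>k. (norm (\<alpha> k n))\<^sup>2) sums 1"
  using orthonormal[of n n] by (intro entries_of_unit_sequence) simp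

lemma entry_le_1: "norm (\<alpha> k n) \<le> 1"
  using orthonormal[of n n] by (intro entries_of_unit_sequence) simp

lemma off_diagonal_le_neighbours:
  assumes "n0 \<le> n" "1 \<le> k" "k \<noteq> n" "norm (\<alpha> (k - 1) n) \<le> X" "norm (\<alpha> (k + 1) n) \<le> X"
  shows "norm (\<alpha> k n) \<le> 4 * C * X / wt k n"
proof -
  have X: "0 \<le> X" using assms(4) norm_ge_zero order_trans by blast
  have "wt k n * norm (\<alpha> k n) \<le> 2 * (real k * \<bar>real k - real n\<bar> * norm (\<alpha> k n))"
    using assms(2) by (simp add: wt_def mult.assoc[symmetric] mult_right_mono)
  also have "\<dots> \<le> 2 * (C * (X + X))"
    using neighbours[OF assms(1,2)] C assms(4,5)
    by (intro mult_left_mono order_trans[OF neighbours[OF assms(1,2)]] add_mono) auto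
  finally show ?thesis using wt_pos[OF assms(3)] by (simp add: field_simps)
qed

lemma off_diagonal_le_inverse_wt:
  assumes "n0 \<le> n" "1 \<le> k" "k \<noteq> n"
  shows "norm (\<alpha> k n) \<le> 4 * C / wt k n"
  using off_diagonal_le_neighbours[OF assms entry_le_1 entry_le_1] by simp

text \<open>
  Orthogonality of the columns \<open>K\<close> and \<open>m\<close> expresses the product of their zeroth entries through the
  remaining ones. Column \<open>K\<close> is summable, so a uniform bound \<open>d\<close> for the entries of column \<open>m\<close> away from
  the diagonal carries over to its zeroth entry; near the diagonal column \<open>K\<close> is itself of
  size \<open>1/m\<^sup>2\<close>.
\<close>

lemma zeroth_entry_step:
  assumes A: "\<And>k. norm (\<alpha> k K) \<le> A / (real k + 1)\<^sup>2"
    and "m \<noteq> K" "1 \<le> m" "0 \<le> d"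
    and far: "\<And>k. 1 \<le> k \<Longrightarrow> 2 \<le> \<bar>real k - real m\<bar> \<Longrightarrow> norm (\<alpha> k m) \<le> d"
  shows "norm (\<alpha> 0 K) * norm (\<alpha> 0 m) \<le> A * (d * (\<Sum>k. 1 / (real k + 1)\<^sup>2) + 3 / (real m)\<^sup>2)"
proof -
  define S where "S = (\<Sum>k. 1 / (real k + 1)\<^sup>2)"
  have A0: "0 \<le> A" using A[of 0] norm_ge_zero[of "\<alpha> 0 K"] by (simp del: norm_ge_zero)
  define t where "t k = \<alpha> k m * cnj (\<alpha> k K)" for k
  \<comment> \<open>the contribution of the three entries next to the diagonal of column \<open>m\<close>\<close>
  define w where "w k = (if k \<in> {m - 1..m + 1} then A / (real m)\<^sup>2 else 0)" for k
  define g where "g k = A * d * (1 / (real k + 1)\<^sup>2) + w k" for k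
  have w_sums: "w sums (\<Sum>k\<in>{m - 1..m + 1}. A / (real m)\<^sup>2)"
    unfolding w_def by (rule sums_If_finite_set) simp
  have "(\<Sum>k\<in>{m - 1..m + 1}. A / (real m)\<^sup>2) = 3 * (A / (real m)\<^sup>2)" using assms(3) by simp
  then have g_sums: "g sums (A * d * S + 3 * (A / (real m)\<^sup>2))"
    unfolding g_def[abs_def] S_def using w_sums
    by (intro sums_add sums_mult summable_sums summable_inverse_Suc_squared) auto
  have g0: "0 \<le> g k" for k using A0 assms(4) by (auto simp: g_def w_def)
  have tg: "norm (t k) \<le> g k" if "1 \<le> k" for k
  proof (cases "k \<in> {m - 1..m + 1}")
    case True
    have "norm (t k) \<le> 1 * (A / (real k + 1)\<^sup>2)"
      unfolding t_def norm_mult using entry_le_1 A by (intro mult_mono) auto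
    also have "\<dots> \<le> A / (real m)\<^sup>2"
      using True assms(3) A0 by (auto intro!: divide_left_mono power_mono)
    also have "\<dots> \<le> g k" using True A0 assms(4) by (simp add: g_def w_def)
    finally show ?thesis .
  next
    case False
    then have "norm (\<alpha> k m) \<le> d" using that assms(3) by (intro far) auto
    then have "norm (t k) \<le> d * (A / (real k + 1)\<^sup>2)"
      unfolding t_def norm_mult using A assms(4) by (intro mult_mono) auto
    also have "\<dots> = g k" using False by (auto simp: g_def w_def mult.commute)
    finally show ?thesis .
  qed
  have t_sums: "t sums 0" using orthonormal[of m K] assms(2) by (simp add: t_def[abs_def])
  then have t_Suc: "(\<lambda>k. t (Suc k)) sums (- t 0)" by (simp add: sums_Suc_iff)
  have gS: "summable (\<lambda>k. g (Suc k))" using g_sums by (simp add: sums_iff summable_Suc_iff)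
  have sn: "summable (\<lambda>k. norm (t (Suc k)))"
    by (rule summable_comparison_test'[OF gS, of 0]) (simp add: tg)
  have "norm (t 0) = norm (\<Sum>k. t (Suc k))" using t_Suc by (simp add: sums_iff)
  also have "\<dots> \<le> (\<Sum>k. norm (t (Suc k)))" by (rule summable_norm[OF sn])
  also have "\<dots> \<le> (\<Sum>k. g (Suc k))" by (intro suminf_le sn gS tg) simp
  also have "\<dots> \<le> g 0 + (\<Sum>k. g (Suc k))" using g0 by simp
  also have "\<dots> = suminf g" using g_sums by (simp add: sums_iff suminf_split_head)
  also have "\<dots> = A * d * S + 3 * (A / (real m)\<^sup>2)" using g_sums by (simp add: sums_iff)
  finally show ?thesis by (simp add: t_def norm_mult S_def algebra_simps)
qed

text \<open>
  If some late column \<open>K\<close> has a nonzero zeroth entry, that entry can be divided out of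
  \<open>zeroth_entry_step\<close>. With the bound \<open>1/m\<close> for the other entries this gives \<open>\<alpha> 0 m = O(1/m)\<close>. Now all
  off-diagonal entries of column \<open>m\<close> are \<open>O(1/m)\<close>, the recursion improves those at distance at least
  two to \<open>O(1/m\<^sup>2)\<close>, and a second application of the step does the same for the zeroth one.
\<close>

lemma zeroth_entry_le: "\<exists>X\<ge>0. \<forall>m\<ge>n0. norm (\<alpha> 0 m) \<le> X / (real m)\<^sup>2"
proof (cases "\<exists>K\<ge>n0. \<alpha> 0 K \<noteq> 0")
  case False
  then show ?thesis by (intro exI[of _ 0]) auto
next
  case True
  then obtain K where K: "n0 \<le> K" "\<alpha> 0 K \<noteq> 0" by auto
  obtain A where A: "\<And>k. norm (\<alpha> k K) \<le> A / (real k + 1)\<^sup>2" using decay[of K] by auto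
  have A0: "0 \<le> A" using A[of 0] norm_ge_zero[of "\<alpha> 0 K"] by (simp del: norm_ge_zero)
  define S where "S = (\<Sum>k. 1 / (real k + 1)\<^sup>2)"
  have S: "0 \<le> S" unfolding S_def by (intro suminf_nonneg summable_inverse_Suc_squared) auto
  define y where "y = norm (\<alpha> 0 K)"
  have y: "0 < y" using K by (simp add: y_def)
  define X1 where "X1 = A * (4 * C * S + 3) / y"
  define X where "X = max X1 (4 * C)"
  define X2 where "X2 = A * (4 * C * X * S + 3) / y"
  have X: "0 \<le> X" "X1 \<le> X" "4 * C \<le> X" using C by (auto simp: X_def)
  have main: "norm (\<alpha> 0 m) \<le> X2 / (real m)\<^sup>2" if m: "n0 \<le> m" "m \<noteq> K" for m
  proof -
    have m1: "1 \<le> m" using m n0 by simp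
    have wt_frac: "Y / wt k m \<le> Y / real m" if "k \<noteq> m" "0 \<le> Y" for k Y
      using that m1 wt_ge[OF that(1)] by (intro divide_left_mono) auto
    have first: "norm (\<alpha> k m) \<le> 4 * C / real m" if "1 \<le> k" "k \<noteq> m" for k
      using off_diagonal_le_inverse_wt[OF m(1) that] wt_frac[of k "4 * C"] that C by simp
    have "y * norm (\<alpha> 0 m) \<le> A * (4 * C / real m * S + 3 / (real m)\<^sup>2)"
      unfolding y_def S_def using m(2) m1 C first by (intro zeroth_entry_step A) auto
    also have "\<dots> \<le> A * (4 * C / real m * S + 3 / real m)"
      using m1 A0 by (intro mult_left_mono add_left_mono divide_left_mono) (auto simp: power2_eq_square)
    also have "\<dots> = y * (X1 / real m)" using y m1 by (simp add: X1_def field_simps)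
    finally have zero: "norm (\<alpha> 0 m) \<le> X1 / real m" using y by (simp only: mult_le_cancel_left_pos)
    have all: "norm (\<alpha> k m) \<le> X / real m" if "k \<noteq> m" for k
    proof (cases "k = 0")
      case True
      have "X1 / real m \<le> X / real m" using X(2) by (rule divide_right_mono) simp
      then show ?thesis using zero True by simp
    next
      case False
      then have "norm (\<alpha> k m) \<le> 4 * C / real m" using first that by simp
      also have "\<dots> \<le> X / real m" using X(3) by (rule divide_right_mono) simp
      finally show ?thesis .
    qed
    have second: "norm (\<alpha> k m) \<le> 4 * C * X / (real m)\<^sup>2" if "1 \<le> k" "2 \<le> \<bar>real k - real m\<bar>" for k
    proof -
      have ne: "k \<noteq> m" "k - 1 \<noteq> m" "k + 1 \<noteq> m" using that by auto
      have "norm (\<alpha> k m) \<le> 4 * C * (X / real m) / wt k m"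
        by (rule off_diagonal_le_neighbours[OF m(1) that(1) ne(1) all[OF ne(2)] all[OF ne(3)]])
      also have "\<dots> \<le> 4 * C * (X / real m) / real m" using ne(1) C X(1) by (intro wt_frac) auto
      finally show ?thesis by (simp add: power2_eq_square)
    qed
    \<comment> \<open>The same step once more, fed with the improved bound.\<close>
    have "y * norm (\<alpha> 0 m) \<le> A * (4 * C * X / (real m)\<^sup>2 * S + 3 / (real m)\<^sup>2)"
      unfolding y_def S_def using m(2) m1 C X second by (intro zeroth_entry_step A) auto
    also have "\<dots> = y * (X2 / (real m)\<^sup>2)" using y m1 by (simp add: X2_def field_simps)
    finally show ?thesis using y by (simp only: mult_le_cancel_left_pos)
  qed
  have X2: "0 \<le> X2" using A0 C X S y by (simp add: X2_def)
  \<comment> \<open>The summand \<open>K\<^sup>2\<close> takes care of the column \<open>K\<close> itself.\<close>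
  have "norm (\<alpha> 0 m) \<le> (X2 + (real K)\<^sup>2) / (real m)\<^sup>2" if m: "n0 \<le> m" for m
  proof (cases "m = K")
    case True
    then show ?thesis using entry_le_1[of 0 K] m n0 X2 by (simp add: add_divide_distrib add_increasing)
  next
    case False
    then have "norm (\<alpha> 0 m) \<le> X2 / (real m)\<^sup>2" using main m by simp
    also have "\<dots> \<le> (X2 + (real K)\<^sup>2) / (real m)\<^sup>2" by (intro divide_right_mono) auto
    finally show ?thesis .
  qed
  then show ?thesis using X2 by (intro exI[of _ "X2 + (real K)\<^sup>2"]) auto
qed

text \<open>
  Two rounds of the recursion. Passing from \<open>k\<close> to \<open>k \<plusminus> 1\<close> changes the weight by at most a factor
  \<open>4\<close> as long as \<open>k \<ge> 1\<close> and \<open>\<bar>k - n\<bar> \<ge> 2\<close>, so the first bound for the neighbours is one for \<open>k\<close>.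
\<close>

lemma off_diagonal_decay:
  "\<exists>A>0. \<forall>n\<ge>n0. \<forall>k. (k \<noteq> n \<longrightarrow> norm (\<alpha> k n) \<le> A / wt k n)
      \<and> (2 \<le> \<bar>real k - real n\<bar> \<longrightarrow> norm (\<alpha> k n) \<le> A / (wt k n)\<^sup>2)"
proof -
  obtain X where X: "0 \<le> X" "\<And>m. n0 \<le> m \<Longrightarrow> norm (\<alpha> 0 m) \<le> X / (real m)\<^sup>2"
    using zeroth_entry_le by auto
  define A1 where "A1 = X + 4 * C"
  have A1: "0 < A1" using X C by (simp add: A1_def)
  define A where "A = A1 + 16 * C * A1"
  have first: "norm (\<alpha> k n) \<le> A1 / wt k n" if n: "n0 \<le> n" "k \<noteq> n" for n k
  proof (cases "k = 0")
    case True
    have n1: "1 \<le> real n" using n n0 by simp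
    have "norm (\<alpha> k n) \<le> X / (real n)\<^sup>2" using X(2)[OF n(1)] True by simp
    also have "\<dots> \<le> X / real n"
      using n1 X(1) by (intro divide_left_mono) (auto simp: power2_eq_square)
    also have "\<dots> \<le> A1 / real n" using C by (intro divide_right_mono) (auto simp: A1_def)
    also have "real n = wt k n" using True by (simp add: wt_def)
    finally show ?thesis .
  next
    case False
    then have "norm (\<alpha> k n) \<le> 4 * C / wt k n" using n by (intro off_diagonal_le_inverse_wt) auto
    also have "\<dots> \<le> A1 / wt k n"
      using X wt_pos[OF n(2)] by (intro divide_right_mono) (auto simp: A1_def)
    finally show ?thesis .
  qed
  have second: "norm (\<alpha> k n) \<le> A / (wt k n)\<^sup>2" if n: "n0 \<le> n" and k: "2 \<le> \<bar>real k - real n\<bar>" for n k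
  proof (cases "k = 0")
    case True
    have "norm (\<alpha> k n) \<le> X / (real n)\<^sup>2" using X(2)[OF n] True by simp
    also have "\<dots> \<le> A / (real n)\<^sup>2" using C A1 by (intro divide_right_mono) (auto simp: A_def A1_def X(1))
    also have "real n = wt k n" using True by (simp add: wt_def)
    finally show ?thesis .
  next
    case False
    have ne: "k \<noteq> n" "k - 1 \<noteq> n" "k + 1 \<noteq> n" using k False by auto
    have near: "norm (\<alpha> j n) \<le> 4 * A1 / wt k n"
      if "j \<noteq> n" "real k + 1 \<le> 2 * (real j + 1)" "\<bar>real k - real n\<bar> \<le> 2 * \<bar>real j - real n\<bar>" for j
    proof -
      have "wt k n \<le> (2 * (real j + 1)) * (2 * \<bar>real j - real n\<bar>)"
        unfolding wt_def using that by (intro mult_mono) auto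
      also have "\<dots> = 4 * wt j n" by (simp add: wt_def)
      finally have "A1 / wt j n \<le> 4 * A1 / wt k n"
        using A1 wt_pos[OF ne(1)] wt_pos[OF that(1)] by (simp add: field_simps)
      then show ?thesis using first[OF n that(1)] by simp
    qed
    have "norm (\<alpha> k n) \<le> 4 * C * (4 * A1 / wt k n) / wt k n"
      using k False by (intro off_diagonal_le_neighbours[OF n _ ne(1)] near ne)
        (auto simp: of_nat_diff abs_if split: if_splits)
    also have "\<dots> = 16 * C * A1 / (wt k n)\<^sup>2" by (simp add: power2_eq_square)
    also have "\<dots> \<le> A / (wt k n)\<^sup>2" using A1 by (intro divide_right_mono) (auto simp: A_def)
    finally show ?thesis .
  qed
  have "norm (\<alpha> k n) \<le> A / wt k n" if "n0 \<le> n" "k \<noteq> n" for k n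
    using first[OF that] by (rule order_trans) (use wt_pos[OF that(2)] A1 C in \<open>auto intro!: divide_right_mono simp: A_def\<close>)
  moreover have "0 < A" using A1 C by (simp add: A_def add_pos_pos)
  ultimately show ?thesis using second by blast
qed

text \<open>
  The source of the cancellation. In the relations expressing that column \<open>n\<close> is a unit vector and
  that columns \<open>n\<close> and \<open>n + 1\<close> are orthogonal, only the diagonal entry, respectively the products
  involving a diagonal entry, are larger than \<open>O(1/n\<^sup>2)\<close>. The second estimate is the orthogonality relation
  multiplied by two diagonal entries, the form in which it enters the products of basis functions.
\<close>

lemma almost_isometry:
  "\<exists>A>0. \<forall>n\<ge>n0. 1 - (norm (\<alpha> n n))\<^sup>2 \<le> A / (real n + 1)\<^sup>2 \<and>
     norm (cnj (\<alpha> (Suc n) (Suc n)) * \<alpha> n (Suc n) + \<alpha> n n * cnj (\<alpha> (Suc n) n)) \<le> A / (real n + 1)\<^sup>2"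
proof -
  obtain A where A: "0 < A" "\<And>n k. n0 \<le> n \<Longrightarrow> k \<noteq> n \<Longrightarrow> norm (\<alpha> k n) \<le> A / wt k n"
    using off_diagonal_decay by blast
  obtain Z where Z: "0 < Z"
    "\<And>n N. (\<Sum>k\<in>{..N} - {n}. (real k + 1) powr 0 / (wt k n)\<^sup>2) \<le> Z * (real n + 1) powr (0 - 2)"
    using sum_powr_over_wt_squared_le[of 0] by auto
  have "(real n + 1) powr (0 - 2) = 1 / (real n + 1)\<^sup>2" for n
    by (simp add: powr_minus_divide del: powr_zero_eq_one)
  then have Z': "(\<Sum>k\<in>{..N} - {n}. 1 / (wt k n)\<^sup>2) \<le> Z / (real n + 1)\<^sup>2" for n N
    using Z(2)[where n = n and N = N] by simp
  define B where "B = A\<^sup>2 * Z"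
  have B: "0 < B" using A Z by (simp add: B_def)
  have off: "(\<Sum>k\<in>{..N} - {n}. (norm (\<alpha> k n))\<^sup>2) \<le> B / (real n + 1)\<^sup>2" if "n0 \<le> n" for n N
  proof -
    have "(\<Sum>k\<in>{..N} - {n}. (norm (\<alpha> k n))\<^sup>2) \<le> (\<Sum>k\<in>{..N} - {n}. A\<^sup>2 * (1 / (wt k n)\<^sup>2))"
    proof (intro sum_mono)
      fix k assume "k \<in> {..N} - {n}"
      then have "(norm (\<alpha> k n))\<^sup>2 \<le> (A / wt k n)\<^sup>2" using A(2)[OF that, of k] by (intro power_mono) auto
      then show "(norm (\<alpha> k n))\<^sup>2 \<le> A\<^sup>2 * (1 / (wt k n)\<^sup>2)" by (simp add: power_divide)
    qed
    also have "\<dots> \<le> A\<^sup>2 * (Z / (real n + 1)\<^sup>2)"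
      unfolding sum_distrib_left[symmetric] by (intro mult_left_mono Z') auto
    finally show ?thesis by (simp add: B_def)
  qed
  have diag: "1 - (norm (\<alpha> n n))\<^sup>2 \<le> B / (real n + 1)\<^sup>2" if "n0 \<le> n" for n
  proof -
    have "(\<lambda>N. \<Sum>k\<le>N. (norm (\<alpha> k n))\<^sup>2) \<longlonglongrightarrow> 1"
      using norm_squares_sum[of n] by (simp add: sums_def_le)
    moreover have "\<forall>N\<ge>n. (\<Sum>k\<le>N. (norm (\<alpha> k n))\<^sup>2) \<le> (norm (\<alpha> n n))\<^sup>2 + B / (real n + 1)\<^sup>2"
      using off[OF that] by (auto simp: sum.remove[where x = n])
    ultimately have "1 \<le> (norm (\<alpha> n n))\<^sup>2 + B / (real n + 1)\<^sup>2"
      by (intro LIMSEQ_le_const2) auto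
    then show ?thesis by simp
  qed
  have cross: "norm (\<alpha> n (Suc n) * cnj (\<alpha> n n) + \<alpha> (Suc n) (Suc n) * cnj (\<alpha> (Suc n) n)) \<le> B / (real n + 1)\<^sup>2"
    if n: "n0 \<le> n" for n
  proof -
    define t where "t k = \<alpha> k (Suc n) * cnj (\<alpha> k n)" for k
    have "(\<lambda>N. norm (t n + t (Suc n) - (\<Sum>k\<le>N. t k))) \<longlonglongrightarrow> norm (t n + t (Suc n) - 0)"
      using orthonormal[of "Suc n" n] unfolding t_def[symmetric]
      by (intro tendsto_intros) (simp add: sums_def_le)
    moreover have "norm (t n + t (Suc n) - (\<Sum>k\<le>N. t k)) \<le> B / (real n + 1)\<^sup>2" if "Suc n \<le> N" for N
    proof -
      define R where "R = {..N} - {n} - {Suc n}"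
      have "(\<Sum>k\<le>N. t k) = t n + (t (Suc n) + sum t R)"
        unfolding R_def using that by (subst sum.remove[where x = n], simp, simp, subst sum.remove[where x = "Suc n"]) auto
      then have "norm (t n + t (Suc n) - (\<Sum>k\<le>N. t k)) = norm (sum t R)" by (simp add: norm_minus_commute)
      also have "\<dots> \<le> (\<Sum>k\<in>R. norm (t k))" by (rule norm_sum)
      also have "\<dots> \<le> (\<Sum>k\<in>R. ((norm (\<alpha> k (Suc n)))\<^sup>2 + (norm (\<alpha> k n))\<^sup>2) / 2)"
      proof (rule sum_mono)
        fix k
        show "norm (t k) \<le> ((norm (\<alpha> k (Suc n)))\<^sup>2 + (norm (\<alpha> k n))\<^sup>2) / 2"
          using sum_squares_bound[of "norm (\<alpha> k (Suc n))" "norm (\<alpha> k n)"]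
          by (simp add: t_def norm_mult)
      qed
      also have "\<dots> = ((\<Sum>k\<in>R. (norm (\<alpha> k (Suc n)))\<^sup>2) + (\<Sum>k\<in>R. (norm (\<alpha> k n))\<^sup>2)) / 2"
        by (simp add: sum.distrib sum_divide_distrib[symmetric])
      also have "\<dots> \<le> (B / (real n + 1)\<^sup>2 + B / (real n + 1)\<^sup>2) / 2"
      proof (intro divide_right_mono add_mono)
        have "(\<Sum>k\<in>R. (norm (\<alpha> k (Suc n)))\<^sup>2) \<le> (\<Sum>k\<in>{..N} - {Suc n}. (norm (\<alpha> k (Suc n)))\<^sup>2)"
          unfolding R_def by (intro sum_mono2) auto
        also have "\<dots> \<le> B / (real (Suc n) + 1)\<^sup>2" using off[of "Suc n" N] n by simp
        also have "\<dots> \<le> B / (real n + 1)\<^sup>2" using B by (intro divide_left_mono power_mono) auto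
        finally show "(\<Sum>k\<in>R. (norm (\<alpha> k (Suc n)))\<^sup>2) \<le> B / (real n + 1)\<^sup>2" .
        have "(\<Sum>k\<in>R. (norm (\<alpha> k n))\<^sup>2) \<le> (\<Sum>k\<in>{..N} - {n}. (norm (\<alpha> k n))\<^sup>2)"
          unfolding R_def by (intro sum_mono2) auto
        also have "\<dots> \<le> B / (real n + 1)\<^sup>2" using off[of n N] n by simp
        finally show "(\<Sum>k\<in>R. (norm (\<alpha> k n))\<^sup>2) \<le> B / (real n + 1)\<^sup>2" .
      qed simp
      finally show ?thesis by simp
    qed
    ultimately have "norm (t n + t (Suc n) - 0) \<le> B / (real n + 1)\<^sup>2"
      by (intro LIMSEQ_le_const2) auto
    then show ?thesis by (simp add: t_def)
  qed
  have "norm (cnj (\<alpha> (Suc n) (Suc n)) * \<alpha> n (Suc n) + \<alpha> n n * cnj (\<alpha> (Suc n) n)) \<le> 3 * B / (real n + 1)\<^sup>2"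
    if n: "n0 \<le> n" for n
  proof -
    define b b' c d where "b = \<alpha> n n" and "b' = \<alpha> (Suc n) (Suc n)" and "c = \<alpha> n (Suc n)" and "d = \<alpha> (Suc n) n"
    define e where "e = B / (real n + 1)\<^sup>2"
    have le1: "norm b \<le> 1" "norm b' \<le> 1" "norm c \<le> 1" "norm d \<le> 1"
      by (simp_all add: b_def b'_def c_def d_def entry_le_1)
    have sq: "b * cnj b = of_real ((norm b)\<^sup>2)" "b' * cnj b' = of_real ((norm b')\<^sup>2)"
      by (simp_all only: complex_norm_square)
    \<comment> \<open>Diagonal entries have modulus nearly one, so multiplying by them loses only \<open>O(1/n\<^sup>2)\<close>.\<close>
    have "cnj b' * c + b * cnj d = cnj b' * b * (c * cnj b + b' * cnj d)
        + (1 - b * cnj b) * (cnj b' * c) + (1 - b' * cnj b') * (b * cnj d)"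
      by (simp add: algebra_simps)
    also have "norm \<dots> \<le> norm (cnj b' * b * (c * cnj b + b' * cnj d))
        + norm ((1 - b * cnj b) * (cnj b' * c)) + norm ((1 - b' * cnj b') * (b * cnj d))"
      by (intro norm_triangle_le add_right_mono norm_triangle_ineq)
    also have "\<dots> \<le> 1 * 1 * e + e * (1 * 1) + e * (1 * 1)"
    proof (intro add_mono)
      show "norm (cnj b' * b * (c * cnj b + b' * cnj d)) \<le> 1 * 1 * e"
        unfolding norm_mult complex_mod_cnj using le1 cross[OF n]
        by (intro mult_mono) (auto simp: b_def b'_def c_def d_def e_def)
      have nd: "norm (1 - of_real ((norm z)\<^sup>2) :: complex) = 1 - (norm z)\<^sup>2" if "norm z \<le> 1" for z :: complex
      proof -
        have "norm (1 - of_real ((norm z)\<^sup>2) :: complex) = \<bar>1 - (norm z)\<^sup>2\<bar>"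
          using norm_of_real[of "1 - (norm z)\<^sup>2", where 'a = complex] by simp
        then show ?thesis using that by (simp add: abs_square_le_1)
      qed
      show "norm ((1 - b * cnj b) * (cnj b' * c)) \<le> e * (1 * 1)"
        unfolding norm_mult sq nd[OF le1(1)] complex_mod_cnj using le1 diag[OF n] B
        by (intro mult_mono) (auto simp: b_def e_def)
      have "1 - (norm b')\<^sup>2 \<le> B / (real (Suc n) + 1)\<^sup>2" using diag[of "Suc n"] n by (simp add: b'_def)
      also have "\<dots> \<le> e" unfolding e_def using B by (intro divide_left_mono power_mono) auto
      finally show "norm ((1 - b' * cnj b') * (b * cnj d)) \<le> e * (1 * 1)"
        unfolding norm_mult sq nd[OF le1(2)] complex_mod_cnj using le1 B
        by (intro mult_mono) (auto simp: e_def)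
    qed
    finally show ?thesis by (simp add: b_def b'_def c_def d_def e_def)
  qed
  moreover have "1 - (norm (\<alpha> n n))\<^sup>2 \<le> 3 * B / (real n + 1)\<^sup>2" if "n0 \<le> n" for n
    using diag[OF that] by (rule order_trans) (use B in \<open>auto intro!: divide_right_mono\<close>)
  ultimately show ?thesis using B by (intro exI[of _ "3 * B"]) auto
qed

end

section \<open>Rank-one operators\<close>

definition rank_one ::
    "'a measure \<Rightarrow> ('a \<Rightarrow> complex) \<Rightarrow> ('a \<Rightarrow> complex) \<Rightarrow> ('a \<Rightarrow> complex) \<Rightarrow> 'a \<Rightarrow> complex" where
  "rank_one M u v f = (\<lambda>x. L2_inner M f v * u x)"

definition bounded_by ::
    "'a measure \<Rightarrow> real \<Rightarrow> real \<Rightarrow> (('a \<Rightarrow> complex) \<Rightarrow> 'a \<Rightarrow> complex) \<Rightarrow> bool" where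
  "bounded_by M p c T \<longleftrightarrow> (\<forall>f\<in>Lp M p. T f \<in> Lp M p \<and> Lp_norm M p (T f) \<le> c * Lp_norm M p f)"

definition Lp_ball :: "'a measure \<Rightarrow> real \<Rightarrow> real \<Rightarrow> ('a \<Rightarrow> complex) set" where
  "Lp_ball M p r = {f \<in> Lp M p. Lp_norm M p f \<le> r}"

lemma Lp_ball_mono: "f \<in> Lp_ball M p r \<Longrightarrow> r \<le> s \<Longrightarrow> f \<in> Lp_ball M p s"
  by (simp add: Lp_ball_def)

lemma Lp_ball_add:
  "1 \<le> p \<Longrightarrow> f \<in> Lp_ball M p r \<Longrightarrow> g \<in> Lp_ball M p s \<Longrightarrow> (\<lambda>x. f x + g x) \<in> Lp_ball M p (r + s)"
  unfolding Lp_ball_def using Lp_add[of p f M g] by (auto intro: order_trans add_mono)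

lemma Lp_ball_scale:
  assumes "0 < p" "norm c \<le> t" "f \<in> Lp_ball M p r"
  shows "(\<lambda>x. c * f x) \<in> Lp_ball M p (t * r)"
proof -
  have "norm c * Lp_norm M p f \<le> t * r"
    using assms order_trans[OF norm_ge_zero assms(2)] by (intro mult_mono) (auto simp: Lp_ball_def Lp_norm_nonneg)
  then show ?thesis using assms Lp_scale[of p f M c] by (simp add: Lp_ball_def)
qed

lemma bounded_by_rank_one:
  assumes p: "1 < p" and u: "u \<in> Lp_ball M p r" and v: "v \<in> Lp_ball M (dual_index p) s"
  shows "bounded_by M p (r * s) (rank_one M u v)"
  unfolding bounded_by_def
proof (intro ballI conjI)
  fix f assume f: "f \<in> Lp M p"
  have uL: "u \<in> Lp M p" "Lp_norm M p u \<le> r"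
    and vL: "v \<in> Lp M (dual_index p)" "Lp_norm M (dual_index p) v \<le> s"
    using u v by (auto simp: Lp_ball_def)
  show "rank_one M u v f \<in> Lp M p"
    unfolding rank_one_def using p uL by (intro Lp_scale) auto
  have "Lp_norm M p (rank_one M u v f) = norm (L2_inner M f v) * Lp_norm M p u"
    unfolding rank_one_def using p uL by (intro Lp_scale) auto
  also have "\<dots> \<le> (Lp_norm M p f * s) * r"
  proof (intro mult_mono uL)
    have "norm (L2_inner M f v) \<le> Lp_norm M p f * Lp_norm M (dual_index p) v"
      by (rule Hoelder_inequality(2)[OF p f vL(1)])
    also have "\<dots> \<le> Lp_norm M p f * s" by (intro mult_left_mono vL Lp_norm_nonneg)
    finally show "norm (L2_inner M f v) \<le> Lp_norm M p f * s" .
    have "0 \<le> s" using vL(2) Lp_norm_nonneg order_trans by blast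
    then show "0 \<le> Lp_norm M p f * s" by (simp add: Lp_norm_nonneg)
  qed (simp add: Lp_norm_nonneg)
  finally show "Lp_norm M p (rank_one M u v f) \<le> r * s * Lp_norm M p f" by (simp add: mult_ac)
qed

lemma bounded_by_cong:
  assumes "bounded_by M p c S" "\<And>f x. f \<in> Lp M p \<Longrightarrow> T f x = S f x"
  shows "bounded_by M p c T"
proof -
  have "T f = S f" if "f \<in> Lp M p" for f using assms(2)[OF that] by (rule ext)
  then show ?thesis using assms(1) by (simp add: bounded_by_def)
qed

lemma bounded_by_mono: "bounded_by M p c T \<Longrightarrow> c \<le> d \<Longrightarrow> bounded_by M p d T"
  unfolding bounded_by_def by (meson Lp_norm_nonneg mult_right_mono order_trans)

lemma bounded_by_add:
  assumes "1 < p" "bounded_by M p c S" "bounded_by M p d T"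
  shows "bounded_by M p (c + d) (\<lambda>f x. S f x + T f x)"
  unfolding bounded_by_def
proof (intro ballI conjI)
  fix f assume f: "f \<in> Lp M p"
  have S: "S f \<in> Lp M p" "Lp_norm M p (S f) \<le> c * Lp_norm M p f"
    and T: "T f \<in> Lp M p" "Lp_norm M p (T f) \<le> d * Lp_norm M p f"
    using assms f by (auto simp: bounded_by_def)
  show "(\<lambda>x. S f x + T f x) \<in> Lp M p" using assms(1) S(1) T(1) by (intro Lp_add) auto
  have "Lp_norm M p (\<lambda>x. S f x + T f x) \<le> Lp_norm M p (S f) + Lp_norm M p (T f)"
    using assms(1) S(1) T(1) by (intro Lp_add) auto
  then show "Lp_norm M p (\<lambda>x. S f x + T f x) \<le> (c + d) * Lp_norm M p f"
    using S(2) T(2) by (simp add: distrib_right)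
qed

lemma bounded_by_scale:
  assumes "1 < p" "bounded_by M p c T" "norm z \<le> r" "0 \<le> c"
  shows "bounded_by M p (r * c) (\<lambda>f x. z * T f x)"
  unfolding bounded_by_def
proof (intro ballI conjI)
  fix f assume f: "f \<in> Lp M p"
  have T: "T f \<in> Lp M p" "Lp_norm M p (T f) \<le> c * Lp_norm M p f"
    using assms f by (auto simp: bounded_by_def)
  show "(\<lambda>x. z * T f x) \<in> Lp M p" using assms(1) T(1) by (intro Lp_scale) auto
  have "Lp_norm M p (\<lambda>x. z * T f x) = norm z * Lp_norm M p (T f)"
    using assms(1) T(1) by (intro Lp_scale) auto
  also have "\<dots> \<le> r * (c * Lp_norm M p f)"
    using T(2) assms(3) norm_ge_zero[of z] by (intro mult_mono) (auto simp: Lp_norm_nonneg simp del: norm_ge_zero)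
  finally show "Lp_norm M p (\<lambda>x. z * T f x) \<le> r * c * Lp_norm M p f" by (simp add: mult.assoc)
qed

lemma bounded_by_diff:
  assumes "1 < p" "bounded_by M p c S" "bounded_by M p d T" "0 \<le> d"
  shows "bounded_by M p (c + d) (\<lambda>f x. S f x - T f x)"
  using bounded_by_add[OF assms(1,2) bounded_by_scale[OF assms(1,3), of "-1" 1]] assms(4) by simp

lemma bounded_by_sum:
  assumes "1 < p" "finite A" "\<And>i. i \<in> A \<Longrightarrow> bounded_by M p (c i) (T i)"
  shows "bounded_by M p (\<Sum>i\<in>A. c i) (\<lambda>f x. \<Sum>i\<in>A. T i f x)"
  using assms(2,3)
proof (induction rule: finite_induct)
  case empty
  then show ?case using assms(1) by (simp add: bounded_by_def Lp_zero)
next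
  case (insert i A)
  then show ?case using bounded_by_add[OF assms(1), of M "c i" "T i" "sum c A"] by simp
qed

lemma L2_inner_add_right:
  assumes "1 < p" "f \<in> Lp M p" "u \<in> Lp M (dual_index p)" "v \<in> Lp M (dual_index p)"
  shows "L2_inner M f (\<lambda>x. u x + v x) = L2_inner M f u + L2_inner M f v"
  using Hoelder_inequality(1)[OF assms(1,2,3)] Hoelder_inequality(1)[OF assms(1,2,4)]
  by (simp add: L2_inner_def distrib_left)

lemma L2_inner_scale_right: "L2_inner M f (\<lambda>x. c * u x) = cnj c * L2_inner M f u"
  by (simp add: L2_inner_def mult.left_commute[of _ "cnj c"])

lemma L2_inner_diff_left:
  assumes "1 < p" "f \<in> Lp M p" "g \<in> Lp M p" "v \<in> Lp M (dual_index p)"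
  shows "L2_inner M (\<lambda>x. f x - g x) v = L2_inner M f v - L2_inner M g v"
  using Hoelder_inequality(1)[OF assms(1,2,4)] Hoelder_inequality(1)[OF assms(1,3,4)]
  by (simp add: L2_inner_def left_diff_distrib)

lemma proj_op_eq_sum_rank_one:
  assumes "1 < p" "f \<in> Lp M p" "\<And>n. \<phi> n \<in> Lp M (dual_index p)"
  shows "proj_op M \<phi> N f x = (\<Sum>n\<le>N. rank_one M (\<phi> n) (\<phi> n) f x)"
proof -
  have int: "integrable M (\<lambda>y. f y * cnj (\<phi> n y))" for n
    using assms by (intro Hoelder_inequality) auto
  have "proj_op M \<phi> N f x = (\<integral>y. (\<Sum>n\<le>N. \<phi> n x * (f y * cnj (\<phi> n y))) \<partial>M)"
    unfolding proj_op_def kernel_op_def proj_kernel_def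
    by (simp add: sum_distrib_left sum_distrib_right mult_ac)
  also have "\<dots> = (\<Sum>n\<le>N. \<phi> n x * (\<integral>y. f y * cnj (\<phi> n y) \<partial>M))"
    by (subst Bochner_Integration.integral_sum) (use int in auto)
  finally show ?thesis by (simp add: rank_one_def L2_inner_def mult.commute)
qed

section \<open>Transfer of convergence\<close>

text \<open>
  A uniformly bounded sequence of linear operators which tends to \<open>0\<close> on a dense set tends to \<open>0\<close>
  everywhere, by the usual \<open>\<epsilon>/3\<close> argument. Here it is applied to the differences of partial sums.
\<close>

lemma partial_sums_converge_transfer:
  assumes p: "1 < p"
    and mem: "\<And>n. \<phi> n \<in> Lp M (dual_index p)" "\<And>n. \<psi> n \<in> Lp M (dual_index p)"
    and bound: "\<And>N. bounded_by M p B (\<lambda>f x. proj_op M \<psi> N f x - proj_op M \<phi> N f x)"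
    and dense: "dense_Lp M p D"
    and conv: "\<And>f. f \<in> D \<Longrightarrow> Lp_tendsto M p (\<lambda>N. proj_op M \<phi> N f) f"
      "\<And>f. f \<in> D \<Longrightarrow> Lp_tendsto M p (\<lambda>N. proj_op M \<psi> N f) f"
    and \<phi>: "partial_sums_converge M \<phi> p"
  shows "partial_sums_converge M \<psi> p"
  unfolding partial_sums_converge_def
proof
  fix f assume f: "f \<in> Lp M p"
  define \<Delta> where "\<Delta> N f = (\<lambda>x. proj_op M \<psi> N f x - proj_op M \<phi> N f x)" for N f
  have \<Delta>_bound: "\<Delta> N f \<in> Lp M p" "Lp_norm M p (\<Delta> N f) \<le> B * Lp_norm M p f" if "f \<in> Lp M p" for N f
    using bound[of N] that by (auto simp: bounded_by_def \<Delta>_def)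
  have "(\<lambda>N. Lp_norm M p (\<Delta> N f)) \<longlonglongrightarrow> 0"
  proof (rule LIMSEQ_I)
    fix e :: real assume e: "0 < e"
    define c where "c = max B 1"
    have c: "0 < c" "B \<le> c" by (auto simp: c_def)
    have "0 < e / (3 * c)" using e c by simp
    then obtain g where g: "g \<in> D" "Lp_norm M p (\<lambda>x. f x - g x) < e / (3 * c)"
      using dense f unfolding dense_Lp_def by blast
    have gL: "g \<in> Lp M p" using g dense by (auto simp: dense_Lp_def)
    have "\<forall>\<^sub>F N in sequentially. Lp_norm M p (\<lambda>x. proj_op M \<phi> N g x - g x) < e / 3"
      "\<forall>\<^sub>F N in sequentially. Lp_norm M p (\<lambda>x. proj_op M \<psi> N g x - g x) < e / 3"
      using conv[OF g(1)] e by (auto simp: Lp_tendsto_def intro!: order_tendstoD(2)[of _ 0])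
    then have "\<forall>\<^sub>F N in sequentially. norm (Lp_norm M p (\<Delta> N f) - 0) < e"
    proof eventually_elim
      case (elim N)
      have fg: "(\<lambda>x. f x - g x) \<in> Lp M p" using p f gL by (intro Lp_diff) auto
      have P: "(\<lambda>x. proj_op M \<psi> N g x - g x) \<in> Lp M p" "(\<lambda>x. proj_op M \<phi> N g x - g x) \<in> Lp M p"
        using conv[OF g(1)] gL p by (auto simp: Lp_tendsto_def intro!: Lp_diff)
      have "\<Delta> N f x = \<Delta> N (\<lambda>x. f x - g x) x + ((proj_op M \<psi> N g x - g x) - (proj_op M \<phi> N g x - g x))" for x
        unfolding \<Delta>_def proj_op_eq_sum_rank_one[OF p f mem(1)] proj_op_eq_sum_rank_one[OF p f mem(2)]
          proj_op_eq_sum_rank_one[OF p gL mem(1)] proj_op_eq_sum_rank_one[OF p gL mem(2)]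
          proj_op_eq_sum_rank_one[OF p fg mem(1)] proj_op_eq_sum_rank_one[OF p fg mem(2)] rank_one_def
          L2_inner_diff_left[OF p f gL mem(1)] L2_inner_diff_left[OF p f gL mem(2)]
        by (simp add: left_diff_distrib sum_subtractf)
      then have "Lp_norm M p (\<Delta> N f) = Lp_norm M p (\<lambda>x. \<Delta> N (\<lambda>x. f x - g x) x
          + ((proj_op M \<psi> N g x - g x) - (proj_op M \<phi> N g x - g x)))" by presburger
      also have "\<dots> \<le> Lp_norm M p (\<Delta> N (\<lambda>x. f x - g x))
          + Lp_norm M p (\<lambda>x. (proj_op M \<psi> N g x - g x) - (proj_op M \<phi> N g x - g x))"
        by (rule Lp_add(2)[OF _ \<Delta>_bound(1)[OF fg] Lp_diff(1)[OF _ P]]) (use p in auto)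
      also have "\<dots> \<le> B * Lp_norm M p (\<lambda>x. f x - g x)
          + (Lp_norm M p (\<lambda>x. proj_op M \<psi> N g x - g x) + Lp_norm M p (\<lambda>x. proj_op M \<phi> N g x - g x))"
        by (intro add_mono \<Delta>_bound(2)[OF fg] Lp_diff(2)[OF _ P]) (use p in auto)
      also have "B * Lp_norm M p (\<lambda>x. f x - g x) \<le> c * (e / (3 * c))"
        using c g(2) by (intro mult_mono) (auto simp: Lp_norm_nonneg)
      also have "c * (e / (3 * c)) = e / 3" using c by simp
      finally show ?case using elim by (simp add: Lp_norm_nonneg)
    qed
    then show "\<exists>no. \<forall>N\<ge>no. norm (Lp_norm M p (\<Delta> N f) - 0) < e"
      by (simp add: eventually_sequentially)
  qed
  then have null: "Lp_tendsto M p (\<lambda>N. \<Delta> N f) (\<lambda>x. 0)"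
    using \<Delta>_bound(1)[OF f] p by (simp add: Lp_tendsto_def Lp_zero)
  have "Lp_tendsto M p (\<lambda>N. proj_op M \<phi> N f) f" using \<phi> f by (simp add: partial_sums_converge_def)
  from Lp_tendsto_add_null[OF _ this null] p
  show "Lp_tendsto M p (\<lambda>N. proj_op M \<psi> N f) f" by (simp add: \<Delta>_def)
qed

section \<open>Expansions in the first basis\<close>

text \<open>
  Parseval's identity in polarized form, from the continuity of the inner product.
\<close>

lemma L2_inner_expansion_sums:
  assumes \<phi>: "orthonormal_L2 M \<phi>" and f: "f \<in> Lp M 2" and g: "g \<in> Lp M 2"
    and lim: "Lp_tendsto M 2 (\<lambda>N. proj_op M \<phi> N f) f"
  shows "(\<lambda>k. L2_inner M f (\<phi> k) * cnj (L2_inner M g (\<phi> k))) sums L2_inner M f g"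
proof -
  have dual2: "dual_index 2 = 2" by (simp add: dual_index_def)
  have \<phi>2: "\<phi> k \<in> Lp M 2" for k using \<phi> by (simp add: orthonormal_L2_def)
  have swap: "L2_inner M (\<phi> k) g = cnj (L2_inner M g (\<phi> k))" for k
  proof -
    have "L2_inner M (\<phi> k) g = (\<integral>x. cnj (g x * cnj (\<phi> k x)) \<partial>M)" by (simp add: L2_inner_def mult.commute)
    then show ?thesis by (simp only: Bochner_Integration.integral_cnj L2_inner_def)
  qed
  have part: "L2_inner M (proj_op M \<phi> N f) g
      = (\<Sum>k\<le>N. L2_inner M f (\<phi> k) * cnj (L2_inner M g (\<phi> k)))" for N
  proof -
    have int: "integrable M (\<lambda>x. \<phi> k x * cnj (g x))" for k by (intro integrable_L2_mult_cnj \<phi>2 g)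
    define a where "a k = L2_inner M f (\<phi> k)" for k
    have "L2_inner M (proj_op M \<phi> N f) g = (\<integral>x. (\<Sum>k\<le>N. a k * (\<phi> k x * cnj (g x))) \<partial>M)"
      unfolding proj_op_eq[OF \<phi> f] a_def[symmetric] by (simp add: L2_inner_def sum_distrib_right mult.assoc)
    also have "\<dots> = (\<Sum>k\<le>N. a k * L2_inner M (\<phi> k) g)"
      using int by (subst Bochner_Integration.integral_sum) (auto simp: L2_inner_def)
    finally show ?thesis by (simp only: swap a_def)
  qed
  have P: "proj_op M \<phi> N f \<in> Lp M 2" for N using lim by (simp add: Lp_tendsto_def)
  have le: "norm (L2_inner M (proj_op M \<phi> N f) g - L2_inner M f g)
      \<le> Lp_norm M 2 (\<lambda>x. proj_op M \<phi> N f x - f x) * Lp_norm M 2 g" for N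
  proof -
    have "L2_inner M (proj_op M \<phi> N f) g - L2_inner M f g = L2_inner M (\<lambda>x. proj_op M \<phi> N f x - f x) g"
      using L2_inner_diff_left[of 2 "proj_op M \<phi> N f" M f g] P f g by (simp add: dual2)
    then show ?thesis
      using Hoelder_inequality(2)[of 2 "\<lambda>x. proj_op M \<phi> N f x - f x" M g] P f g
      by (simp add: dual2 Lp_diff)
  qed
  have "(\<lambda>N. Lp_norm M 2 (\<lambda>x. proj_op M \<phi> N f x - f x) * Lp_norm M 2 g) \<longlonglongrightarrow> 0 * Lp_norm M 2 g"
    using lim by (intro tendsto_intros) (simp add: Lp_tendsto_def)
  then have bound: "(\<lambda>N. Lp_norm M 2 (\<lambda>x. proj_op M \<phi> N f x - f x) * Lp_norm M 2 g) \<longlonglongrightarrow> 0"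
    by simp
  have "(\<lambda>N. L2_inner M (proj_op M \<phi> N f) g - L2_inner M f g) \<longlonglongrightarrow> 0"
    by (rule Lim_null_comparison[OF always_eventually bound]) (rule allI, rule le)
  then have "(\<lambda>N. L2_inner M (proj_op M \<phi> N f) g) \<longlonglongrightarrow> L2_inner M f g"
    by (rule LIM_zero_cancel)
  then show ?thesis unfolding part by (simp add: sums_def_le)
qed

text \<open>
  The expansion of \<open>f\<close> converges in \<open>L\<^sup>2\<close>, while a norm bound in \<open>L\<^sup>p\<close> is wanted. The partial sums
  obey it by the triangle inequality, and \<open>Lp_of_L2_limit\<close> carries it over to the limit.
\<close>

lemma Lp_expansion_tail:
  assumes p: "1 < p" and \<phi>: "orthonormal_L2 M \<phi>" and f: "f \<in> Lp M 2"
    and lim: "Lp_tendsto M 2 (\<lambda>N. proj_op M \<phi> N f) f"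
    and \<phi>p: "\<And>k. \<phi> k \<in> Lp M p" and S: "finite S"
    and B: "\<And>N. (\<Sum>k\<in>{..N} - S. norm (L2_inner M f (\<phi> k)) * Lp_norm M p (\<phi> k)) \<le> B"
  shows "(\<lambda>x. f x - (\<Sum>k\<in>S. L2_inner M f (\<phi> k) * \<phi> k x)) \<in> Lp M p"
    and "Lp_norm M p (\<lambda>x. f x - (\<Sum>k\<in>S. L2_inner M f (\<phi> k) * \<phi> k x)) \<le> B"
proof -
  have \<phi>2: "\<phi> k \<in> Lp M 2" for k using \<phi> by (simp add: orthonormal_L2_def)
  define a where "a k = L2_inner M f (\<phi> k)" for k
  define g where "g x = f x - (\<Sum>k\<in>S. a k * \<phi> k x)" for x
  \<comment> \<open>Starting the partial sums at \<open>s\<close> makes all of them contain the removed indices.\<close>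
  obtain s where s: "S \<subseteq> {..s}" using S by (metis finite_nat_iff_bounded_le)
  define F where "F N x = (\<Sum>k\<in>{..N + s} - S. a k * \<phi> k x)" for N x
  have Fg: "F N x - g x = proj_op M \<phi> (N + s) f x - f x" for N x
  proof -
    have "(\<Sum>k\<le>N + s. a k * \<phi> k x) = F N x + (\<Sum>k\<in>S. a k * \<phi> k x)"
      unfolding F_def using s by (intro sum.subset_diff) auto
    then show ?thesis by (simp add: proj_op_eq[OF \<phi> f] g_def a_def)
  qed
  have FL: "F N \<in> Lp M p \<and> Lp_norm M p (F N) \<le> B" for N
  proof -
    have summand: "(\<lambda>x. a k * \<phi> k x) \<in> Lp M p" "Lp_norm M p (\<lambda>x. a k * \<phi> k x) = norm (a k) * Lp_norm M p (\<phi> k)" for k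
      using p \<phi>p by (auto intro: Lp_scale)
    have "F N \<in> Lp M p \<and> Lp_norm M p (F N) \<le> (\<Sum>k\<in>{..N + s} - S. Lp_norm M p (\<lambda>x. a k * \<phi> k x))"
      unfolding F_def[abs_def] using p summand by (intro Lp_sum) auto
    moreover have "(\<Sum>k\<in>{..N + s} - S. Lp_norm M p (\<lambda>x. a k * \<phi> k x)) \<le> B"
      unfolding summand(2) unfolding a_def by (rule B)
    ultimately show ?thesis by linarith
  qed
  have g2: "g \<in> Lp M 2"
  proof -
    have "(\<lambda>x. a k * \<phi> k x) \<in> Lp M 2" for k by (intro Lp_scale \<phi>2) simp
    then have "(\<lambda>x. \<Sum>k\<in>S. a k * \<phi> k x) \<in> Lp M 2" using Lp_sum[of 2 S "\<lambda>k x. a k * \<phi> k x" M] S by simp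
    then show ?thesis unfolding g_def[abs_def] using f by (intro Lp_diff) simp_all
  qed
  have B0: "0 \<le> B"
    using B[of 0] by (rule order_trans[rotated]) (intro sum_nonneg mult_nonneg_nonneg norm_ge_zero Lp_norm_nonneg)
  have "g \<in> Lp M p \<and> Lp_norm M p g \<le> B"
  proof (intro conjI)
    have m: "(\<lambda>x. F N x - g x) \<in> Lp M 2" for N
      unfolding Fg using lim f by (intro Lp_diff) (auto simp: Lp_tendsto_def)
    have t: "(\<lambda>N. Lp_norm M 2 (\<lambda>x. F N x - g x)) \<longlonglongrightarrow> 0"
      unfolding Fg using lim LIMSEQ_ignore_initial_segment[of "\<lambda>N. Lp_norm M 2 (\<lambda>x. proj_op M \<phi> N f x - f x)" 0 s]
      by (simp add: Lp_tendsto_def)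
    show "g \<in> Lp M p" "Lp_norm M p g \<le> B"
      using Lp_of_L2_limit[of p g M B F, OF _ Lp_measurable[OF g2] B0 _ _ m t] FL p by auto
  qed
  then show "(\<lambda>x. f x - (\<Sum>k\<in>S. L2_inner M f (\<phi> k) * \<phi> k x)) \<in> Lp M p"
    and "Lp_norm M p (\<lambda>x. f x - (\<Sum>k\<in>S. L2_inner M f (\<phi> k) * \<phi> k x)) \<le> B"
    by (simp_all add: g_def[abs_def] a_def)
qed

section \<open>Comparison of the two bases\<close>

text \<open>
  The algebra behind the telescoping, with every function value and every coefficient
  replaced by a variable: \<open>x\<^sub>i\<close> and \<open>F\<^sub>i\<close> stand for the value and the Fourier coefficient of three
  consecutive functions of the first basis, \<open>r\<close> and \<open>R\<close> for those of the remainder,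
  \<open>b\<close>, \<open>c\<close>, \<open>d\<close> for the three leading coefficients in one column, \<open>s\<close> and \<open>t\<close> for the diagonal entry and the one below it in the preceding column,
  and primed letters for conjugates.
\<close>

lemma tridiagonal_identity:
  fixes b :: complex
  shows "(b' * F1 + (c' * F0 + d' * F2) + R) * (b * x1 + (c * x0 + d * x2) + r) - F1 * x1
      - (b * d' * (F2 * x1) + b' * d * (F1 * x2)) + (s * t' * (F1 * x0) + s' * t * (F0 * x1)) =
    (b * b' - 1) * (F1 * x1) + (c' * F0 + d' * F2) * (c * x0 + d * x2)
      + (b * c' + s' * t) * (F0 * x1) + (b' * c + s * t') * (F1 * x0)
      + R * (b * x1 + (c * x0 + d * x2)) + (b' * F1 + (c' * F0 + d' * F2) + R) * r"
  by (simp add: algebra_simps)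

locale perturbed_basis = near_identity_matrix "\<lambda>k n. L2_inner M (\<psi> n) (\<phi> k)" n0 C
  for M :: "'a measure" and \<phi> \<psi> :: "nat \<Rightarrow> 'a \<Rightarrow> complex" and n0 C +
  assumes \<phi>_orthonormal: "orthonormal_L2 M \<phi>"
    and \<psi>_L2: "\<And>n. \<psi> n \<in> Lp M 2"
    and \<psi>_expansion: "\<And>n. Lp_tendsto M 2 (\<lambda>N. proj_op M \<phi> N (\<psi> n)) (\<psi> n)"
    and \<phi>_Lp: "\<And>q n. 1 < q \<Longrightarrow> \<phi> n \<in> Lp M q"
begin

abbreviation a :: "nat \<Rightarrow> nat \<Rightarrow> complex" where
  "a k n \<equiv> L2_inner M (\<psi> n) (\<phi> k)"

text \<open>
  The expansion of each single \<open>\<psi> n\<close> converges absolutely in \<open>L\<^sup>q\<close>, by the decay of its own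
  coefficients.
\<close>

lemma \<psi>_Lp:
  fixes g L :: real
  assumes q: "1 < q" and g: "g < 1" and L: "\<And>k. Lp_norm M q (\<phi> k) \<le> L * (real k + 1) powr g"
  shows "\<psi> n \<in> Lp M q"
proof -
  obtain A where A: "\<And>k. norm (a k n) \<le> A / (real k + 1)\<^sup>2" using decay by blast
  have A0: "0 \<le> A" using A[of 0] norm_ge_zero[of "a 0 n"] by (simp del: norm_ge_zero)
  have L0: "0 \<le> L" using L[of 0] Lp_norm_nonneg[of M q "\<phi> 0"] by simp
  have "summable (\<lambda>n. real (Suc n) powr (g - 2))"
    using g summable_real_powr_iff[of "g - 2"] by (subst summable_Suc_iff) auto
  then have s: "summable (\<lambda>k. (real k + 1) powr (g - 2))" by (simp add: add.commute)
  have "(\<Sum>k\<in>{..N} - {}. norm (a k n) * Lp_norm M q (\<phi> k)) \<le> A * L * (\<Sum>k. (real k + 1) powr (g - 2))" for N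
  proof -
    have "(\<Sum>k\<in>{..N} - {}. norm (a k n) * Lp_norm M q (\<phi> k))
        \<le> (\<Sum>k\<in>{..N} - {}. A * L * (real k + 1) powr (g - 2))"
    proof (rule sum_mono)
      fix k
      have "norm (a k n) * Lp_norm M q (\<phi> k) \<le> A / (real k + 1)\<^sup>2 * (L * (real k + 1) powr g)"
        using A0 by (intro mult_mono A L) (auto simp: Lp_norm_nonneg)
      also have "\<dots> = A * L * (real k + 1) powr (g - 2)" by (simp add: powr_diff)
      finally show "norm (a k n) * Lp_norm M q (\<phi> k) \<le> A * L * (real k + 1) powr (g - 2)" .
    qed
    also have "\<dots> = A * L * (\<Sum>k\<le>N. (real k + 1) powr (g - 2))" by (simp add: sum_distrib_left)
    also have "\<dots> \<le> A * L * (\<Sum>k. (real k + 1) powr (g - 2))"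
      using A0 L0 s by (intro mult_left_mono sum_le_suminf) auto
    finally show ?thesis .
  qed
  from Lp_expansion_tail(1)[OF q \<phi>_orthonormal \<psi>_L2 \<psi>_expansion \<phi>_Lp[OF q] _ this]
  show ?thesis by simp
qed

text \<open>
  The splitting of \<open>\<psi> (n + 1)\<close> into its three leading terms and the rest. The index is shifted by
  one so that the indices \<open>n\<close>, \<open>n + 1\<close>, \<open>n + 2\<close> occur and no subtraction of natural numbers.
\<close>

definition remainder :: "nat \<Rightarrow> 'a \<Rightarrow> complex" where
  "remainder n x = \<psi> (Suc n) x - (\<Sum>k\<in>{n, Suc n, Suc (Suc n)}. a k (Suc n) * \<phi> k x)"

definition neighbour_part :: "nat \<Rightarrow> 'a \<Rightarrow> complex" where
  "neighbour_part n x = a n (Suc n) * \<phi> n x + a (Suc (Suc n)) (Suc n) * \<phi> (Suc (Suc n)) x"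

definition main_part :: "nat \<Rightarrow> 'a \<Rightarrow> complex" where
  "main_part n x = a (Suc n) (Suc n) * \<phi> (Suc n) x + neighbour_part n x"

lemma \<psi>_split: "\<psi> (Suc n) x = main_part n x + remainder n x"
  by (simp add: main_part_def neighbour_part_def remainder_def)

lemma remainder_bound:
  fixes g L :: real
  assumes q: "1 < q" and g: "0 \<le> g" "g < 1" and L: "\<And>k. Lp_norm M q (\<phi> k) \<le> L * (real k + 1) powr g"
  shows "\<exists>B\<ge>0. \<forall>n\<ge>n0. remainder n \<in> Lp_ball M q (B * (real n + 2) powr (g - 2))"
proof -
  obtain A where A: "0 < A"
    "\<And>n k. n0 \<le> n \<Longrightarrow> 2 \<le> \<bar>real k - real n\<bar> \<Longrightarrow> norm (a k n) \<le> A / (wt k n)\<^sup>2"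
    using off_diagonal_decay by blast
  have L0: "0 \<le> L" using L[of 0] Lp_norm_nonneg[of M q "\<phi> 0"] by simp
  obtain Z where Z: "0 < Z"
    "\<And>n N. (\<Sum>k\<in>{..N} - {n}. (real k + 1) powr g / (wt k n)\<^sup>2) \<le> Z * (real n + 1) powr (g - 2)"
    using sum_powr_over_wt_squared_le[OF g] by auto
  have "remainder n \<in> Lp_ball M q (A * L * Z * (real n + 2) powr (g - 2))"
    if n: "n0 \<le> n" for n
  proof -
    define S where "S = {n, Suc n, Suc (Suc n)}"
    have tail: "(\<Sum>k\<in>{..N} - S. norm (a k (Suc n)) * Lp_norm M q (\<phi> k)) \<le> A * L * Z * (real n + 2) powr (g - 2)" for N
    proof -
      have "(\<Sum>k\<in>{..N} - S. norm (a k (Suc n)) * Lp_norm M q (\<phi> k))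
          \<le> (\<Sum>k\<in>{..N} - S. A * L * ((real k + 1) powr g / (wt k (Suc n))\<^sup>2))"
      proof (rule sum_mono)
        fix k assume "k \<in> {..N} - S"
        then have k: "2 \<le> \<bar>real k - real (Suc n)\<bar>" by (auto simp: S_def)
        have "norm (a k (Suc n)) * Lp_norm M q (\<phi> k) \<le> A / (wt k (Suc n))\<^sup>2 * (L * (real k + 1) powr g)"
          using A(1) n k by (intro mult_mono A(2) L) (auto simp: Lp_norm_nonneg)
        then show "norm (a k (Suc n)) * Lp_norm M q (\<phi> k) \<le> A * L * ((real k + 1) powr g / (wt k (Suc n))\<^sup>2)"
          by (simp add: mult_ac)
      qed
      also have "\<dots> = A * L * (\<Sum>k\<in>{..N} - S. (real k + 1) powr g / (wt k (Suc n))\<^sup>2)"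
        by (simp add: sum_distrib_left)
      also have "\<dots> \<le> A * L * (\<Sum>k\<in>{..N} - {Suc n}. (real k + 1) powr g / (wt k (Suc n))\<^sup>2)"
        using A(1) L0 by (intro mult_left_mono sum_mono2) (auto simp: S_def)
      also have "\<dots> \<le> A * L * (Z * (real (Suc n) + 1) powr (g - 2))"
        using A(1) L0 by (intro mult_left_mono Z) auto
      finally show ?thesis by (simp add: mult_ac add_ac)
    qed
    have "finite S" by (simp add: S_def)
    from Lp_expansion_tail[OF q \<phi>_orthonormal \<psi>_L2 \<psi>_expansion \<phi>_Lp[OF q] this tail]
    show ?thesis by (simp add: Lp_ball_def remainder_def[abs_def] S_def)
  qed
  then show ?thesis using A L0 Z by (intro exI[of _ "A * L * Z"]) auto
qed

lemma neighbour_coefficients: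
  "\<exists>A>0. \<forall>n\<ge>n0. norm (a n (Suc n)) \<le> A / (real n + 2) \<and> norm (a (Suc n) n) \<le> A / (real n + 2)"
proof -
  obtain A where A: "0 < A" "\<And>n k. n0 \<le> n \<Longrightarrow> k \<noteq> n \<Longrightarrow> norm (a k n) \<le> A / wt k n"
    using off_diagonal_decay by blast
  have "norm (a n (Suc n)) \<le> 2 * A / (real n + 2) \<and> norm (a (Suc n) n) \<le> 2 * A / (real n + 2)"
    if n: "n0 \<le> n" for n
  proof
    have "norm (a n (Suc n)) \<le> A / (real n + 1)" using A(2)[of "Suc n" n] n by (simp add: wt_def)
    also have "\<dots> \<le> 2 * A / (real n + 2)" using A(1) by (simp add: field_simps)
    finally show "norm (a n (Suc n)) \<le> 2 * A / (real n + 2)" .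
    have "norm (a (Suc n) n) \<le> A / (real n + 2)" using A(2)[of n "Suc n"] n by (simp add: wt_def add_ac)
    also have "\<dots> \<le> 2 * A / (real n + 2)" using A(1) by (intro divide_right_mono) auto
    finally show "norm (a (Suc n) n) \<le> 2 * A / (real n + 2)" .
  qed
  then show ?thesis using A(1) by (intro exI[of _ "2 * A"]) auto
qed

text \<open>
  The sizes of all functions that enter the splitting of \<open>\<psi> (n + 1)\<close>, relative to the growth exponent
  \<open>g\<close> of the first basis in \<open>L\<^sup>q\<close>. It is used for \<open>q = p\<close> and for \<open>q\<close> dual to \<open>p\<close>.
\<close>

definition controlled :: "real \<Rightarrow> real \<Rightarrow> real \<Rightarrow> nat \<Rightarrow> bool" where
  "controlled q g P n \<longleftrightarrow>
     (\<forall>j\<in>{n, Suc n, Suc (Suc n)}. \<phi> j \<in> Lp_ball M q (P * (real n + 2) powr g)) \<and>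
     \<psi> (Suc n) \<in> Lp_ball M q (P * (real n + 2) powr g) \<and>
     main_part n \<in> Lp_ball M q (P * (real n + 2) powr g) \<and>
     neighbour_part n \<in> Lp_ball M q (P * (real n + 2) powr (g - 1)) \<and>
     remainder n \<in> Lp_ball M q (P * (real n + 2) powr (g - 2))"

lemma components_controlled:
  fixes g L :: real
  assumes q: "1 < q" and g: "0 \<le> g" "g < 1" and L: "\<And>k. Lp_norm M q (\<phi> k) \<le> L * (real k + 1) powr g"
  shows "\<exists>P\<ge>0. \<forall>n\<ge>n0. controlled q g P n"
proof -
  obtain B where B: "0 \<le> B"
    "\<And>n. n0 \<le> n \<Longrightarrow> remainder n \<in> Lp_ball M q (B * (real n + 2) powr (g - 2))"
    using remainder_bound[OF assms] by auto
  obtain A where A: "0 < A" "\<And>n. n0 \<le> n \<Longrightarrow> norm (a n (Suc n)) \<le> A / (real n + 2)"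
    "\<And>n. n0 \<le> n \<Longrightarrow> norm (a (Suc n) n) \<le> A / (real n + 2)"
    using neighbour_coefficients by blast
  have L0: "0 \<le> L" using L[of 0] Lp_norm_nonneg[of M q "\<phi> 0"] by simp
  have q1: "1 \<le> q" "0 < q" using q by auto
  define U where "U = 4 * A * L"
  define V where "V = 2 * L + U"
  define P where "P = V + B"
  have UV: "0 \<le> U" "0 \<le> V" "U \<le> P" "V \<le> P" "2 * L \<le> P" "B \<le> P" "0 \<le> P"
    using A(1) L0 B(1) by (auto simp: U_def V_def P_def)
  have "controlled q g P n" if n: "n0 \<le> n" for n
  proof -
    define x where "x = real n + 2"
    have x: "2 \<le> x" by (simp add: x_def)
    have powr_le: "c * x powr s \<le> d * x powr t" if "c \<le> d" "0 \<le> c" "s \<le> t" for c d s t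
      using that x by (intro mult_mono powr_mono) auto
    have \<phi>: "\<phi> j \<in> Lp_ball M q (2 * L * x powr g)" if "j \<in> {n, Suc n, Suc (Suc n)}" for j
    proof -
      have "Lp_norm M q (\<phi> j) \<le> L * (real j + 1) powr g" by (rule L)
      also have "\<dots> \<le> L * (2 * x) powr g"
        using that L0 g by (intro mult_left_mono powr_mono2) (auto simp: x_def)
      also have "(2 * x) powr g = 2 powr g * x powr g" by (rule powr_mult)
      also have "L * (2 powr g * x powr g) \<le> L * (2 * x powr g)"
        using powr_mono[of g 1 "2::real"] g L0 by (intro mult_left_mono mult_right_mono) auto
      finally show ?thesis using \<phi>_Lp[OF q] by (simp add: Lp_ball_def)
    qed
    have c: "norm (a n (Suc n)) \<le> A / x" using A(2)[OF n] by (simp add: x_def)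
    have d: "norm (a (Suc (Suc n)) (Suc n)) \<le> A / x"
    proof -
      have "norm (a (Suc (Suc n)) (Suc n)) \<le> A / (real (Suc n) + 2)" using A(3)[of "Suc n"] n by simp
      also have "\<dots> \<le> A / x" using A(1) by (intro divide_left_mono) (auto simp: x_def)
      finally show ?thesis .
    qed
    have "neighbour_part n \<in> Lp_ball M q (A / x * (2 * L * x powr g) + A / x * (2 * L * x powr g))"
      unfolding neighbour_part_def[abs_def] by (intro Lp_ball_add Lp_ball_scale q1 c d \<phi>) auto
    also have "A / x * (2 * L * x powr g) + A / x * (2 * L * x powr g) = U * x powr (g - 1)"
      using x by (simp add: U_def powr_diff)
    finally have neighbour: "neighbour_part n \<in> Lp_ball M q (U * x powr (g - 1))" .
    have "main_part n \<in> Lp_ball M q (1 * (2 * L * x powr g) + U * x powr (g - 1))"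
      unfolding main_part_def[abs_def]
      by (intro Lp_ball_add Lp_ball_scale q1 entry_le_1 neighbour \<phi>) auto
    moreover have "1 * (2 * L * x powr g) + U * x powr (g - 1) \<le> V * x powr g"
      using powr_le[of U U "g - 1" g] UV by (simp add: V_def distrib_right)
    ultimately have main: "main_part n \<in> Lp_ball M q (V * x powr g)" by (rule Lp_ball_mono)
    have rem: "remainder n \<in> Lp_ball M q (B * x powr (g - 2))" using B(2)[OF n] by (simp add: x_def)
    have "\<psi> (Suc n) = (\<lambda>x. main_part n x + remainder n x)" by (rule ext) (rule \<psi>_split)
    then have "\<psi> (Suc n) \<in> Lp_ball M q (V * x powr g + B * x powr (g - 2))"
      using Lp_ball_add[OF q1(1) main rem] by simp
    moreover have "V * x powr g + B * x powr (g - 2) \<le> P * x powr g"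
      using powr_le[of B B "g - 2" g] B(1) by (simp add: P_def distrib_right)
    ultimately have \<psi>: "\<psi> (Suc n) \<in> Lp_ball M q (P * x powr g)" by (rule Lp_ball_mono)
    show ?thesis
      unfolding controlled_def x_def[symmetric]
      using \<psi> Lp_ball_mono[OF \<phi> powr_le] Lp_ball_mono[OF main powr_le]
        Lp_ball_mono[OF neighbour powr_le] Lp_ball_mono[OF rem powr_le] UV L0 B(1) by auto
  qed
  then show ?thesis using UV(7) by blast
qed

text \<open>
  The part of \<open>\<psi> n \<otimes> \<psi> n\<close> that couples \<open>\<phi> n\<close> and \<open>\<phi> (n + 1)\<close>. The next increment
  contains its negative up to a summable error, hence it survives only at the ends of the sum.
\<close>

definition boundary_term :: "nat \<Rightarrow> ('a \<Rightarrow> complex) \<Rightarrow> 'a \<Rightarrow> complex" where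
  "boundary_term n f x =
     a n n * cnj (a (Suc n) n) * rank_one M (\<phi> n) (\<phi> (Suc n)) f x
     + cnj (a n n * cnj (a (Suc n) n)) * rank_one M (\<phi> (Suc n)) (\<phi> n) f x"

definition increment :: "nat \<Rightarrow> ('a \<Rightarrow> complex) \<Rightarrow> 'a \<Rightarrow> complex" where
  "increment n f x = rank_one M (\<psi> n) (\<psi> n) f x - rank_one M (\<phi> n) (\<phi> n) f x"

context
  fixes p g g' L L' :: real
  assumes p: "1 < p" and g: "0 \<le> g" "0 \<le> g'" "g + g' < 1"
    and L: "\<And>k. Lp_norm M p (\<phi> k) \<le> L * (real k + 1) powr g"
    and L': "\<And>k. Lp_norm M (dual_index p) (\<phi> k) \<le> L' * (real k + 1) powr g'"
begin

lemma \<psi>_in_Lp: "\<psi> n \<in> Lp M p" and \<psi>_in_dual_Lp: "\<psi> n \<in> Lp M (dual_index p)"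
  using \<psi>_Lp[OF p _ L] \<psi>_Lp[OF dual_index(1)[OF p] _ L'] g by auto

text \<open>
  Each of the six terms on the right is of order \<open>n\<^sup>-\<^sup>2\<close> relative to the product of the norms: the scalars by
  \<open>almost_isometry\<close>, the square of the neighbour part because it has two factors of order \<open>1/n\<close>, and
  the last two because of the remainder.
\<close>

lemma increment_eq:
  assumes f: "f \<in> Lp M p"
    and mem: "neighbour_part n \<in> Lp M (dual_index p)" "main_part n \<in> Lp M (dual_index p)"
      "remainder n \<in> Lp M (dual_index p)"
  shows "increment (Suc n) f x - boundary_term (Suc n) f x + boundary_term n f x =
      (a (Suc n) (Suc n) * cnj (a (Suc n) (Suc n)) - 1) * rank_one M (\<phi> (Suc n)) (\<phi> (Suc n)) f x
      + rank_one M (neighbour_part n) (neighbour_part n) f x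
      + cnj (cnj (a (Suc n) (Suc n)) * a n (Suc n) + a n n * cnj (a (Suc n) n))
          * rank_one M (\<phi> (Suc n)) (\<phi> n) f x
      + (cnj (a (Suc n) (Suc n)) * a n (Suc n) + a n n * cnj (a (Suc n) n))
          * rank_one M (\<phi> n) (\<phi> (Suc n)) f x
      + rank_one M (main_part n) (remainder n) f x
      + rank_one M (remainder n) (\<psi> (Suc n)) f x"
proof -
  have q: "1 < dual_index p" "0 < dual_index p" using dual_index(1)[OF p] by auto
  have scaled: "(\<lambda>x. c * \<phi> k x) \<in> Lp M (dual_index p)" for c k
    using q \<phi>_Lp[OF q(1)] by (intro Lp_scale) auto
  define F where "F k = L2_inner M f (\<phi> k)" for k
  define R where "R = L2_inner M f (remainder n)"
  have N: "L2_inner M f (neighbour_part n) = cnj (a n (Suc n)) * F n + cnj (a (Suc (Suc n)) (Suc n)) * F (Suc (Suc n))"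
    unfolding neighbour_part_def[abs_def] L2_inner_add_right[OF p f scaled scaled] by (simp add: L2_inner_scale_right F_def)
  have m: "L2_inner M f (main_part n) = cnj (a (Suc n) (Suc n)) * F (Suc n) + L2_inner M f (neighbour_part n)"
    unfolding main_part_def[abs_def] L2_inner_add_right[OF p f scaled mem(1)] by (simp add: L2_inner_scale_right F_def)
  have \<psi>_eq: "\<psi> (Suc n) = (\<lambda>x. main_part n x + remainder n x)" by (rule ext) (rule \<psi>_split)
  have \<psi>: "L2_inner M f (\<psi> (Suc n)) = L2_inner M f (main_part n) + R"
    using L2_inner_add_right[OF p f mem(2,3)] by (simp only: \<psi>_eq[symmetric] R_def)
  show ?thesis
    unfolding increment_def boundary_term_def rank_one_def \<psi> m N R_def[symmetric] F_def[symmetric]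
    unfolding complex_cnj_add complex_cnj_mult complex_cnj_cnj
    by (subst \<psi>_split, (subst main_part_def)+, (subst neighbour_part_def)+, rule tridiagonal_identity)
qed

lemma corrected_increment_bound:
  "\<exists>K\<ge>0. \<forall>n\<ge>n0. bounded_by M p (K * (real n + 2) powr (g + g' - 2))
     (\<lambda>f x. increment (Suc n) f x - boundary_term (Suc n) f x + boundary_term n f x)"
proof -
  have lt: "g < 1" "g' < 1" using g by auto
  obtain P where P: "0 \<le> P" "\<And>n. n0 \<le> n \<Longrightarrow> controlled p g P n"
    using components_controlled[OF p g(1) lt(1) L] by blast
  obtain P' where P': "0 \<le> P'" "\<And>n. n0 \<le> n \<Longrightarrow> controlled (dual_index p) g' P' n"
    using components_controlled[OF dual_index(1)[OF p] g(2) lt(2) L'] by blast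
  obtain A where A: "0 < A" and iso: "\<And>n. n0 \<le> n \<Longrightarrow> 1 - (norm (a n n))\<^sup>2 \<le> A / (real n + 1)\<^sup>2 \<and>
     norm (cnj (a (Suc n) (Suc n)) * a n (Suc n) + a n n * cnj (a (Suc n) n)) \<le> A / (real n + 1)\<^sup>2"
    using almost_isometry by blast
  have "bounded_by M p ((12 * A * (P * P') + 3 * (P * P')) * (real n + 2) powr (g + g' - 2))
     (\<lambda>f x. increment (Suc n) f x - boundary_term (Suc n) f x + boundary_term n f x)"
    if n: "n0 \<le> n" for n
  proof -
    define x where "x = real n + 2"
    have x: "2 \<le> x" by (simp add: x_def)
    note ctrl = P(2)[OF n, unfolded controlled_def, folded x_def]
      P'(2)[OF n, unfolded controlled_def, folded x_def]
    define \<epsilon> where "\<epsilon> = 4 * A / x\<^sup>2"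
    define w where "w = x powr (g + g')"
    have shrink: "A / (real n + 1)\<^sup>2 \<le> \<epsilon>"
    proof -
      have "(x / 2)\<^sup>2 \<le> (real n + 1)\<^sup>2" by (intro power_mono) (auto simp: x_def)
      then have "A / (real n + 1)\<^sup>2 \<le> A / (x / 2)\<^sup>2" using A x by (intro divide_left_mono) auto
      then show ?thesis by (simp add: \<epsilon>_def power_divide mult.commute)
    qed
    define z where "z = cnj (a (Suc n) (Suc n)) * a n (Suc n) + a n n * cnj (a (Suc n) n)"
    have z: "norm z \<le> \<epsilon>" using iso[OF n] shrink by (simp add: z_def)
    define y where "y = a (Suc n) (Suc n) * cnj (a (Suc n) (Suc n)) - 1"
    have y: "norm y \<le> \<epsilon>"
    proof -
      have "y = - of_real (1 - (norm (a (Suc n) (Suc n)))\<^sup>2)"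
        by (simp add: y_def complex_norm_square[symmetric])
      then have "norm y = \<bar>1 - (norm (a (Suc n) (Suc n)))\<^sup>2\<bar>" by (simp only: norm_minus_cancel norm_of_real)
      also have "\<dots> = 1 - (norm (a (Suc n) (Suc n)))\<^sup>2" using entry_le_1[of "Suc n" "Suc n"] by (simp add: abs_square_le_1)
      also have "\<dots> \<le> A / (real (Suc n) + 1)\<^sup>2" using iso[of "Suc n"] n by simp
      also have "\<dots> \<le> A / (real n + 1)\<^sup>2" using A by (intro divide_left_mono power_mono) auto
      finally show ?thesis using shrink by linarith
    qed
    have rank: "bounded_by M p (P * P' * x powr (s + t)) (rank_one M u v)"
      if "u \<in> Lp_ball M p (P * x powr s)" "v \<in> Lp_ball M (dual_index p) (P' * x powr t)" for u v s t
      using bounded_by_rank_one[OF p that] by (simp add: powr_add mult_ac)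
    have \<phi>\<phi>: "bounded_by M p (P * P' * w) (rank_one M (\<phi> i) (\<phi> j))"
      if "i \<in> {n, Suc n, Suc (Suc n)}" "j \<in> {n, Suc n, Suc (Suc n)}" for i j
      unfolding w_def using ctrl that by (intro rank) blast+
    have scaled: "bounded_by M p (\<epsilon> * (P * P' * w)) (\<lambda>f x. c * rank_one M (\<phi> i) (\<phi> j) f x)"
      if "norm c \<le> \<epsilon>" "i \<in> {n, Suc n, Suc (Suc n)}" "j \<in> {n, Suc n, Suc (Suc n)}" for c i j
      using \<phi>\<phi>[OF that(2,3)] that(1) by (intro bounded_by_scale p) (auto simp: w_def P(1) P'(1))
    have w2: "w / x\<^sup>2 = x powr (g + g' - 2)" using x by (simp add: w_def powr_diff)
    have uu: "bounded_by M p (P * P' * (w / x\<^sup>2)) (rank_one M (neighbour_part n) (neighbour_part n))"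
      unfolding w2 using rank[where u = "neighbour_part n" and v = "neighbour_part n" and s = "g - 1" and t = "g' - 1"] ctrl by simp
    have mr: "bounded_by M p (P * P' * (w / x\<^sup>2)) (rank_one M (main_part n) (remainder n))"
      unfolding w2 using rank[where u = "main_part n" and v = "remainder n" and s = "g" and t = "g' - 2"] ctrl by (simp add: add_diff_eq)
    have r\<psi>: "bounded_by M p (P * P' * (w / x\<^sup>2)) (rank_one M (remainder n) (\<psi> (Suc n)))"
      unfolding w2 using rank[where u = "remainder n" and v = "\<psi> (Suc n)" and s = "g - 2" and t = "g'"] ctrl by (simp add: diff_add_eq)
    have cz: "norm (cnj z) \<le> \<epsilon>" using z by simp
    have total: "bounded_by M p (\<epsilon> * (P * P' * w) + P * P' * (w / x\<^sup>2) + \<epsilon> * (P * P' * w) + \<epsilon> * (P * P' * w)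
        + P * P' * (w / x\<^sup>2) + P * P' * (w / x\<^sup>2))
      (\<lambda>f x. y * rank_one M (\<phi> (Suc n)) (\<phi> (Suc n)) f x
      + rank_one M (neighbour_part n) (neighbour_part n) f x
      + cnj z * rank_one M (\<phi> (Suc n)) (\<phi> n) f x
      + z * rank_one M (\<phi> n) (\<phi> (Suc n)) f x
      + rank_one M (main_part n) (remainder n) f x
      + rank_one M (remainder n) (\<psi> (Suc n)) f x)"
      by (intro bounded_by_add p scaled uu mr r\<psi> y z cz) auto
    have bound_eq: "\<epsilon> * (P * P' * w) + P * P' * (w / x\<^sup>2) + \<epsilon> * (P * P' * w) + \<epsilon> * (P * P' * w)
        + P * P' * (w / x\<^sup>2) + P * P' * (w / x\<^sup>2) = (12 * A * (P * P') + 3 * (P * P')) * (w / x\<^sup>2)"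
      by (simp add: \<epsilon>_def algebra_simps)
    show ?thesis
      unfolding x_def[symmetric] w2[symmetric] bound_eq[symmetric]
      by (rule bounded_by_cong[OF total], unfold y_def z_def, rule increment_eq) (use ctrl in \<open>auto simp: Lp_ball_def\<close>)
  qed
  then show ?thesis using A P(1) P'(1) by (intro exI[of _ "12 * A * (P * P') + 3 * (P * P')"]) auto
qed

text \<open>
  A single boundary term has size \<open>n powr (g + g' - 1)\<close>, which is bounded since \<open>g + g' < 1\<close>.
\<close>

lemma boundary_term_bound: "\<exists>K\<ge>0. \<forall>n\<ge>n0. bounded_by M p K (boundary_term n)"
proof -
  obtain A where A: "0 < A" "\<And>n. n0 \<le> n \<Longrightarrow> norm (a (Suc n) n) \<le> A / (real n + 2)"
    using neighbour_coefficients by blast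
  have L0: "0 \<le> L" using L[of 0] Lp_norm_nonneg[of M p "\<phi> 0"] by simp
  have L0': "0 \<le> L'" using L'[of 0] Lp_norm_nonneg[of M "dual_index p" "\<phi> 0"] by simp
  have "bounded_by M p (A * L * L' + A * L * L') (boundary_term n)" if n: "n0 \<le> n" for n
  proof -
    define x where "x = real n + 2"
    have x: "1 \<le> x" by (simp add: x_def)
    have rank: "bounded_by M p (L * x powr g * (L' * x powr g')) (rank_one M (\<phi> i) (\<phi> j))"
      if "i \<le> Suc n" "j \<le> Suc n" for i j
    proof (intro bounded_by_rank_one p)
      have "L * (real i + 1) powr g \<le> L * x powr g"
        using that g L0 by (intro mult_left_mono powr_mono2) (auto simp: x_def)
      then show "\<phi> i \<in> Lp_ball M p (L * x powr g)"
        using L[of i] \<phi>_Lp[OF p] by (simp add: Lp_ball_def)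
      have "L' * (real j + 1) powr g' \<le> L' * x powr g'"
        using that g L0' by (intro mult_left_mono powr_mono2) (auto simp: x_def)
      then show "\<phi> j \<in> Lp_ball M (dual_index p) (L' * x powr g')"
        using L'[of j] \<phi>_Lp[OF dual_index(1)[OF p]] by (simp add: Lp_ball_def)
    qed
    define e where "e = a n n * cnj (a (Suc n) n)"
    have "norm e \<le> 1 * (A / x)"
      unfolding e_def norm_mult complex_mod_cnj using A(2)[OF n] by (intro mult_mono entry_le_1) (auto simp: x_def)
    then have e: "norm e \<le> A / x" "norm (cnj e) \<le> A / x" by auto
    have le: "A / x * (L * x powr g * (L' * x powr g')) \<le> A * L * L'"
    proof -
      have "x powr g * x powr g' \<le> x"
        using powr_mono[of "g + g'" 1 x] g x by (simp add: powr_add)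
      then have "A * L * L' * (x powr g * x powr g' / x) \<le> A * L * L' * 1"
        using A(1) L0 L0' x by (intro mult_left_mono) auto
      then show ?thesis by (simp add: mult_ac)
    qed
    have "bounded_by M p (A * L * L') (\<lambda>f x. c * rank_one M (\<phi> i) (\<phi> j) f x)"
      if "norm c \<le> A / x" "i \<le> Suc n" "j \<le> Suc n" for c i j
      using L0 L0' by (intro bounded_by_mono[OF bounded_by_scale[OF p rank[OF that(2,3)] that(1)] le]) auto
    then show ?thesis
      unfolding boundary_term_def[abs_def] e_def[symmetric] using e by (intro bounded_by_add p) auto
  qed
  then show ?thesis using A L0 L0' by (intro exI[of _ "A * L * L' + A * L * L'"]) auto
qed

lemma partial_sums_differ_boundedly:
  "\<exists>B. \<forall>N. bounded_by M p B (\<lambda>f x. proj_op M \<psi> N f x - proj_op M \<phi> N f x)"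
proof -
  have q: "1 < dual_index p" by (rule dual_index(1)[OF p])
  note \<psi>_mem = \<psi>_in_Lp \<psi>_in_dual_Lp
  have "\<exists>c\<ge>0. bounded_by M p c (increment n)" for n
  proof -
    have "bounded_by M p (Lp_norm M p (\<psi> n) * Lp_norm M (dual_index p) (\<psi> n)
        + Lp_norm M p (\<phi> n) * Lp_norm M (dual_index p) (\<phi> n)) (increment n)"
      unfolding increment_def[abs_def]
      by (intro bounded_by_diff bounded_by_rank_one p mult_nonneg_nonneg Lp_norm_nonneg)
         (simp_all add: Lp_ball_def \<psi>_mem \<phi>_Lp p q)
    moreover have "0 \<le> Lp_norm M p (\<psi> n) * Lp_norm M (dual_index p) (\<psi> n)
        + Lp_norm M p (\<phi> n) * Lp_norm M (dual_index p) (\<phi> n)" by (simp add: Lp_norm_nonneg)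
    ultimately show ?thesis by blast
  qed
  then obtain c where c: "\<And>n. 0 \<le> c n" "\<And>n. bounded_by M p (c n) (increment n)" by metis
  obtain K where K: "0 \<le> K" "\<And>n. n0 \<le> n \<Longrightarrow> bounded_by M p (K * (real n + 2) powr (g + g' - 2))
     (\<lambda>f x. increment (Suc n) f x - boundary_term (Suc n) f x + boundary_term n f x)"
    using corrected_increment_bound by blast
  obtain T where T: "0 \<le> T" "\<And>n. n0 \<le> n \<Longrightarrow> bounded_by M p T (boundary_term n)"
    using boundary_term_bound by blast
  have "summable (\<lambda>n. real (Suc (Suc n)) powr (g + g' - 2))"
    using g summable_real_powr_iff[of "g + g' - 2"] summable_Suc_iff[of "\<lambda>n. real n powr (g + g' - 2)"]
      summable_Suc_iff[of "\<lambda>n. real (Suc n) powr (g + g' - 2)"] by simp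
  then have s: "summable (\<lambda>n. (real n + 2) powr (g + g' - 2))" by (simp add: add.commute)
  define Z where "Z = (\<Sum>n. (real n + 2) powr (g + g' - 2))"
  have Z: "0 \<le> Z" unfolding Z_def using s by (intro suminf_nonneg) auto
  define B where "B = sum c {..n0} + K * Z + T + T"
  have difference: "proj_op M \<psi> N f x - proj_op M \<phi> N f x = (\<Sum>n\<le>N. increment n f x)"
    if "f \<in> Lp M p" for N f x
    unfolding increment_def proj_op_eq_sum_rank_one[OF p that \<psi>_mem(2)]
      proj_op_eq_sum_rank_one[OF p that \<phi>_Lp[OF q]] by (simp add: sum_subtractf)
  have "bounded_by M p B (\<lambda>f x. \<Sum>n\<le>N. increment n f x)" for N
  proof (cases "N \<le> n0")
    case True
    have bounded: "bounded_by M p (sum c {..N}) (\<lambda>f x. \<Sum>n\<le>N. increment n f x)"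
      using c by (intro bounded_by_sum p) auto
    have "sum c {..N} \<le> sum c {..n0}" using True c by (intro sum_mono2) auto
    moreover have "0 \<le> K * Z" using K(1) Z by simp
    ultimately have "sum c {..N} \<le> B" using T(1) unfolding B_def by linarith
    with bounded show ?thesis by (rule bounded_by_mono)
  next
    case False
    then have N: "n0 \<le> N" by simp
    \<comment> \<open>Up to \<open>n0\<close> only the boundedness of each increment is at hand; from there on the sum telescopes.\<close>
    have telescope: "(\<Sum>n\<le>N. increment n f x) = (\<Sum>n\<le>n0. increment n f x)
        + (\<Sum>n\<in>{n0..<N}. increment (Suc n) f x - boundary_term (Suc n) f x + boundary_term n f x)
        + boundary_term N f x - boundary_term n0 f x" for f x
      using N by (induction N rule: dec_induct) (auto simp: algebra_simps)
    have "bounded_by M p (sum c {..n0} + (\<Sum>n\<in>{n0..<N}. K * (real n + 2) powr (g + g' - 2)) + T + T)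
        (\<lambda>f x. (\<Sum>n\<le>n0. increment n f x)
        + (\<Sum>n\<in>{n0..<N}. increment (Suc n) f x - boundary_term (Suc n) f x + boundary_term n f x)
        + boundary_term N f x - boundary_term n0 f x)"
      using N by (intro bounded_by_diff bounded_by_add bounded_by_sum p c K T) auto
    moreover have "(\<Sum>n\<in>{n0..<N}. K * (real n + 2) powr (g + g' - 2)) \<le> K * Z"
      unfolding sum_distrib_left[symmetric] Z_def using K s by (intro mult_left_mono sum_le_suminf) auto
    ultimately show ?thesis unfolding telescope B_def by (elim bounded_by_mono) auto
  qed
  then have "bounded_by M p B (\<lambda>f x. proj_op M \<psi> N f x - proj_op M \<phi> N f x)" for N
    by (rule bounded_by_cong) (rule difference)
  then show ?thesis by blast
qed

end

end

section \<open>The hypotheses on the coefficients and the norms\<close>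

text \<open>
  The growth condition with \<open>k + 1\<close> in place of \<open>k\<close>, so that it also covers the function with index \<open>0\<close>.
\<close>

lemma norm_growth_shifted:
  assumes "norm_growth M p0 \<phi>"
  obtains \<gamma> :: "real \<Rightarrow> real" where "\<And>q n. 1 < q \<Longrightarrow> \<phi> n \<in> Lp M q"
    and "\<And>q. 1 < q \<Longrightarrow> 0 \<le> \<gamma> q" and "\<And>q. 1 < q \<Longrightarrow> \<gamma> q + \<gamma> (dual_index q) < 1"
    and "\<And>q. 1 < q \<Longrightarrow> \<exists>L. \<forall>k. Lp_norm M q (\<phi> k) \<le> L * (real k + 1) powr \<gamma> q"
proof -
  obtain \<gamma> :: "real \<Rightarrow> real" where \<gamma>: "\<And>q. 1 < q \<Longrightarrow> (\<forall>n. \<phi> n \<in> Lp M q) \<and> 0 \<le> \<gamma> q \<and>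
      (\<exists>C>0. \<forall>n\<ge>1. Lp_norm M q (\<phi> n) \<le> C * real n powr \<gamma> q) \<and> \<gamma> q + \<gamma> (dual_index q) < 1"
    using assms unfolding norm_growth_def by metis
  have "\<exists>L. \<forall>k. Lp_norm M q (\<phi> k) \<le> L * (real k + 1) powr \<gamma> q" if q: "1 < q" for q
  proof -
    obtain C where C: "0 < C" "\<And>n. 1 \<le> n \<Longrightarrow> Lp_norm M q (\<phi> n) \<le> C * real n powr \<gamma> q"
      using \<gamma>[OF q] by auto
    have "Lp_norm M q (\<phi> k) \<le> (C + Lp_norm M q (\<phi> 0)) * (real k + 1) powr \<gamma> q" for k
    proof (cases "k = 0")
      case True
      then show ?thesis using C(1) by simp
    next
      case False
      then have "Lp_norm M q (\<phi> k) \<le> C * real k powr \<gamma> q" by (intro C) simp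
      also have "\<dots> \<le> (C + Lp_norm M q (\<phi> 0)) * (real k + 1) powr \<gamma> q"
        using C(1) \<gamma>[OF q] by (intro mult_mono powr_mono2) (auto simp: Lp_norm_nonneg)
      finally show ?thesis .
    qed
    then show ?thesis by blast
  qed
  then show ?thesis using that[of \<gamma>] \<gamma> by blast
qed

text \<open>
  Since \<open>\<bar>a k\<bar> \<le> 1/2\<close>, the right-hand side of the recursion is at most the mean of the two neighbours,
  in particular at most one. The quadratic growth of the factor for fixed \<open>n\<close> thus gives the decay in
  each column, and its uniform lower bound gives the comparison with the neighbours.
\<close>

lemma near_identity_matrix_of_recursion:
  assumes R: "three_term_recursion \<alpha>"
    and orthonormal: "\<And>m n. (\<lambda>k. \<alpha> k n * cnj (\<alpha> k m)) sums (if n = m then 1 else 0)"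
  obtains n0 C where "near_identity_matrix \<alpha> n0 C"
proof -
  obtain f :: "nat \<Rightarrow> nat \<Rightarrow> complex" and a :: "nat \<Rightarrow> complex" and n1 :: nat and C :: real where
    rec: "\<And>k n. f k n * \<alpha> k n = a k * (if k = 0 then 0 else \<alpha> (k - 1) n) + a (k + 1) * \<alpha> (k + 1) n"
    and a: "\<And>k. norm (a k) \<le> 1 / 2"
    and tail: "\<And>n. \<exists>kn. \<exists>C>0. \<forall>k\<ge>kn. (real k)\<^sup>2 \<le> C * norm (f k n)"
    and C: "0 < C" "\<And>n k. n1 \<le> n \<Longrightarrow> real k * \<bar>real k - real n\<bar> \<le> C * norm (f k n)"
    using R unfolding three_term_recursion_def by metis
  have le1: "norm (\<alpha> k n) \<le> 1" for k n
    using orthonormal[of n n] by (intro entries_of_unit_sequence) simp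
  have rec_le: "norm (f k n) * norm (\<alpha> k n)
      \<le> (norm (if k = 0 then 0 else \<alpha> (k - 1) n) + norm (\<alpha> (k + 1) n)) / 2" for k n
  proof -
    have "norm (f k n) * norm (\<alpha> k n)
        \<le> norm (a k) * norm (if k = 0 then 0 else \<alpha> (k - 1) n) + norm (a (k + 1)) * norm (\<alpha> (k + 1) n)"
      unfolding norm_mult[symmetric] rec by (rule norm_triangle_ineq)
    also have "\<dots> \<le> 1 / 2 * norm (if k = 0 then 0 else \<alpha> (k - 1) n) + 1 / 2 * norm (\<alpha> (k + 1) n)"
      by (intro add_mono mult_right_mono a norm_ge_zero)
    finally show ?thesis by (simp add: add_divide_distrib)
  qed
  have "near_identity_matrix \<alpha> (max n1 1) C"
  proof
    fix k n :: nat
    assume n: "max n1 1 \<le> n" and k: "1 \<le> k"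
    have "real k * \<bar>real k - real n\<bar> * norm (\<alpha> k n) \<le> C * norm (f k n) * norm (\<alpha> k n)"
      using n by (intro mult_right_mono C) auto
    also have "\<dots> \<le> C * ((norm (\<alpha> (k - 1) n) + norm (\<alpha> (k + 1) n)) / 2)"
      using rec_le[of k n] k C(1) by (simp add: mult.assoc)
    also have "\<dots> \<le> C * (norm (\<alpha> (k - 1) n) + norm (\<alpha> (k + 1) n))"
      using C(1) by (intro mult_left_mono) (auto simp: field_simps)
    finally show "real k * \<bar>real k - real n\<bar> * norm (\<alpha> k n)
        \<le> C * (norm (\<alpha> (k - 1) n) + norm (\<alpha> (k + 1) n))" .
  next
    fix n :: nat
    obtain kn D where D: "0 < D" "\<And>k. kn \<le> k \<Longrightarrow> (real k)\<^sup>2 \<le> D * norm (f k n)" using tail[of n] by auto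
    have "norm (\<alpha> k n) \<le> (4 * D + (real kn + 1)\<^sup>2) / (real k + 1)\<^sup>2" for k
    proof (cases "kn \<le> k \<and> k \<noteq> 0")
      case True
      have "(real k + 1)\<^sup>2 \<le> (2 * real k)\<^sup>2" using True by (intro power_mono) auto
      then have "(real k + 1)\<^sup>2 * norm (\<alpha> k n) \<le> 4 * (real k)\<^sup>2 * norm (\<alpha> k n)"
        by (intro mult_right_mono) (auto simp: power_mult_distrib)
      also have "\<dots> \<le> 4 * (D * norm (f k n)) * norm (\<alpha> k n)"
        using D(2)[of k] True by (intro mult_right_mono mult_left_mono) auto
      also have "\<dots> = 4 * D * (norm (f k n) * norm (\<alpha> k n))" by simp
      also have "\<dots> \<le> 4 * D * ((1 + 1) / 2)"
        using D(1) True le1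
        by (intro mult_left_mono order_trans[OF rec_le] divide_right_mono add_mono) auto
      finally have "(real k + 1)\<^sup>2 * norm (\<alpha> k n) \<le> 4 * D + (real kn + 1)\<^sup>2"
        by (simp add: add_increasing2)
      then show ?thesis by (simp add: field_simps)
    next
      case False
      then have "(real k + 1)\<^sup>2 * norm (\<alpha> k n) \<le> (real kn + 1)\<^sup>2 * 1"
        by (intro mult_mono power_mono le1) auto
      then have "(real k + 1)\<^sup>2 * norm (\<alpha> k n) \<le> 4 * D + (real kn + 1)\<^sup>2" using D(1) by simp
      then show ?thesis by (simp add: field_simps)
    qed
    then show "\<exists>A. \<forall>k. norm (\<alpha> k n) \<le> A / (real k + 1)\<^sup>2" by blast
  qed (use C(1) orthonormal in auto)
  then show ?thesis by (rule that)
qed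

section \<open>Convergence for the second basis\<close>

theorem theorem2p1:
  fixes M :: "'a measure"
    and \<phi> \<psi> :: "nat \<Rightarrow> 'a \<Rightarrow> complex"
    and p0 p :: real
  assumes infinite_dim: "\<And>q. 1 < q \<Longrightarrow> infinite_dim_Lp M q"
    and separable: "\<And>q. 1 < q \<Longrightarrow> separable_Lp M q"
    and basis_\<phi>: "orthonormal_basis_L2 M \<phi>"
    and basis_\<psi>: "orthonormal_basis_L2 M \<psi>"
    and p0: "1 < p0" "p0 < 2"
    and L: "norm_growth M p0 \<phi>"
    and R: "three_term_recursion (\<lambda>k n. L2_inner M (\<psi> n) (\<phi> k))"
    and B: "shifted_sums_bounded M \<phi>"
    and C: "\<And>q. 1 < q \<Longrightarrow> partial_sums_converge M \<phi> q \<longleftrightarrow> p0 < q \<and> q < dual_index p0"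
    and D: "common_dense_convergence M \<phi> \<psi>"
    and p: "1 < p"
  shows "partial_sums_converge M \<psi> p \<longleftrightarrow> p0 < p \<and> p < dual_index p0"
proof -
  have \<phi>_on: "orthonormal_L2 M \<phi>" and \<psi>_on: "orthonormal_L2 M \<psi>"
    using basis_\<phi> basis_\<psi> by (auto simp: orthonormal_basis_L2_def)
  have \<psi>2: "\<psi> n \<in> Lp M 2" for n using \<psi>_on by (simp add: orthonormal_L2_def)
  \<comment> \<open>The criterion at the exponent 2 provides the expansion of each \<open>\<psi> n\<close> in the first basis.\<close>
  have "2 < dual_index p0" using p0 by (simp add: dual_index_def field_simps)
  then have "partial_sums_converge M \<phi> 2" using C[of 2] p0 by simp
  then have expansion: "Lp_tendsto M 2 (\<lambda>N. proj_op M \<phi> N (\<psi> n)) (\<psi> n)" for n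
    using \<psi>2 by (simp add: partial_sums_converge_def)
  have "(\<lambda>k. L2_inner M (\<psi> n) (\<phi> k) * cnj (L2_inner M (\<psi> m) (\<phi> k))) sums (if n = m then 1 else 0)" for m n
    using L2_inner_expansion_sums[OF \<phi>_on \<psi>2 \<psi>2 expansion, of n m] \<psi>_on by (simp add: orthonormal_L2_def)
  then obtain n0 K where near: "near_identity_matrix (\<lambda>k n. L2_inner M (\<psi> n) (\<phi> k)) n0 K"
    using near_identity_matrix_of_recursion[OF R] by blast
  obtain \<gamma> :: "real \<Rightarrow> real" where \<phi>_Lp: "\<And>q n. 1 < q \<Longrightarrow> \<phi> n \<in> Lp M q"
    and \<gamma>: "\<And>q. 1 < q \<Longrightarrow> 0 \<le> \<gamma> q" "\<And>q. 1 < q \<Longrightarrow> \<gamma> q + \<gamma> (dual_index q) < 1"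
    and growth: "\<And>q. 1 < q \<Longrightarrow> \<exists>L. \<forall>k. Lp_norm M q (\<phi> k) \<le> L * (real k + 1) powr \<gamma> q"
    using norm_growth_shifted[OF L] by metis
  have q: "1 < dual_index p" by (rule dual_index(1)[OF p])
  obtain K1 where K1: "\<And>k. Lp_norm M p (\<phi> k) \<le> K1 * (real k + 1) powr \<gamma> p"
    using growth[OF p] by blast
  obtain K2 where K2: "\<And>k. Lp_norm M (dual_index p) (\<phi> k) \<le> K2 * (real k + 1) powr \<gamma> (dual_index p)"
    using growth[OF q] by blast
  note criterion = C[OF p]
  interpret perturbed_basis M \<phi> \<psi> n0 K
    by (intro perturbed_basis.intro near perturbed_basis_axioms.intro \<phi>_on \<psi>2 expansion \<phi>_Lp)
  note growth_facts = p \<gamma>(1)[OF p] \<gamma>(1)[OF q] \<gamma>(2)[OF p] K1 K2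
  obtain B where B: "\<And>N. bounded_by M p B (\<lambda>f x. proj_op M \<psi> N f x - proj_op M \<phi> N f x)"
    using partial_sums_differ_boundedly[OF growth_facts] by blast
  have B': "bounded_by M p (1 * max B 0) (\<lambda>f x. proj_op M \<phi> N f x - proj_op M \<psi> N f x)" for N
    using bounded_by_scale[OF p bounded_by_mono[OF B, of "max B 0"], of "-1" 1] by simp
  obtain D where D: "dense_Lp M p D" "\<And>f. f \<in> D \<Longrightarrow> Lp_tendsto M p (\<lambda>N. proj_op M \<phi> N f) f"
    "\<And>f. f \<in> D \<Longrightarrow> Lp_tendsto M p (\<lambda>N. proj_op M \<psi> N f) f"
    using D p unfolding common_dense_convergence_def by blast
  have \<psi>q: "\<psi> n \<in> Lp M (dual_index p)" for n by (rule \<psi>_in_dual_Lp[OF growth_facts])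
  have "partial_sums_converge M \<psi> p \<longleftrightarrow> partial_sums_converge M \<phi> p"
    using partial_sums_converge_transfer[OF p \<phi>_Lp[OF q] \<psi>q B D]
      partial_sums_converge_transfer[OF p \<psi>q \<phi>_Lp[OF q] B' D(1,3,2)] by blast
  then show ?thesis using criterion by simp
qed

end
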